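(* Let $\mathcal{H}$ be a complex Hilbert space, let $A\in\mathcal{B}(\mathcal{H})$ be normal, and let $r\geq 1$ be a real number. Then \[ w^{2r}(A)=\frac14\left\||A|^{2r}+|A^*|^{2r}\right\|+\frac12\, r\!\left(|A|^r|A^*|^r\right), \] where $r(\cdot)$ applied to an operator denotes the spectral radius. That is, equality holds at $\theta=\tfrac12$ in the inequality $w^{2r}(A)\leq \frac14\left\| |A|^{4r\theta}+|A^*|^{4r(1-\theta)}\right\| +\frac12\, r\!\left(|A|^{2r\theta}|A^*|^{2r(1-\theta)}\right)$.
   Context: $\mathcal{B}(\mathcal{H})$ is the algebra of bounded linear operators on the complex Hilbert space $\mathcal{H}$, and $\|\cdot\|$ is the operator norm. For $T\in\mathcal{B}(\mathcal{H})$, the numerical radius is $w(T)=\sup\{|\langle Tx,x\rangle| : x\in\mathcal{H},\ \|x\|=1\}$, and $w^{2r}(T)$ means $(w(T))^{2r}$. $|T|=(T^*T)^{1/2}$, so $|T^*|=(TT^* )^{1/2}$. Real powers of positive operators are taken via the continuous functional calculus. The symbol $r$ alone is the real exponent, while $r(T)$ for an operator $T$ is the spectral radius of $T$. *)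

theory Defs
  imports "HOL-Analysis.Analysis" "HOL-Computational_Algebra.Polynomial"
begin

(* The norm, topology, and completeness are those of the underlying real Banach space;
   cinner_self makes the norm the one induced by the inner product, which also yields
   positive definiteness. The inner product is linear in its first argument. *)
class chilbert_space = banach +
  fixes scaleC :: "complex \<Rightarrow> 'a \<Rightarrow> 'a"  (infixr "*\<^sub>C" 75)
    and cinner :: "'a \<Rightarrow> 'a \<Rightarrow> complex"
  assumes scaleC_add_right: "c *\<^sub>C (x + y) = c *\<^sub>C x + c *\<^sub>C y"
    and scaleC_add_left: "(c + d) *\<^sub>C x = c *\<^sub>C x + d *\<^sub>C x"
    and scaleC_scaleC: "c *\<^sub>C (d *\<^sub>C x) = (c * d) *\<^sub>C x"
    and scaleC_of_real: "complex_of_real a *\<^sub>C x = a *\<^sub>R x"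
    and cinner_add_left: "cinner (x + y) z = cinner x z + cinner y z"
    and cinner_scaleC_left: "cinner (c *\<^sub>C x) y = c * cinner x y"
    and cinner_commute: "cinner x y = cnj (cinner y x)"
    and cinner_self: "cinner x x = complex_of_real ((norm x)\<^sup>2)"

instantiation complex :: chilbert_space
begin

definition scaleC_complex :: "complex \<Rightarrow> complex \<Rightarrow> complex"
  where "scaleC_complex c x = c * x"

definition cinner_complex :: "complex \<Rightarrow> complex \<Rightarrow> complex"
  where "cinner_complex x y = x * cnj y"

instance
  by standard
    (simp_all add: scaleC_complex_def cinner_complex_def algebra_simps scaleR_conv_of_real
      complex_norm_square[symmetric])

end

(* B(H), as the complex-linear members of the type of real-linear bounded operators.
   The norm of that type is the operator norm, and o\<^sub>L is the product. *)
definition bounded_ops :: "('a::chilbert_space \<Rightarrow>\<^sub>L 'a) set"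
  where "bounded_ops = {T. \<forall>c x. blinfun_apply T (c *\<^sub>C x) = c *\<^sub>C blinfun_apply T x}"

definition adj_op :: "('a::chilbert_space \<Rightarrow>\<^sub>L 'a) \<Rightarrow> ('a \<Rightarrow>\<^sub>L 'a)"
  where "adj_op T =
    (THE S. \<forall>x y. cinner (blinfun_apply T x) y = cinner x (blinfun_apply S y))"

definition normal_op :: "('a::chilbert_space \<Rightarrow>\<^sub>L 'a) \<Rightarrow> bool"
  where "normal_op T \<longleftrightarrow> adj_op T o\<^sub>L T = T o\<^sub>L adj_op T"

(* The suprema defining the numerical radius and the spectral radius are taken in [0, \<infinity>).
   Inserting 0 changes nothing unless the space is {0}; there it makes the supremum of the
   empty set 0 instead of an unspecified real. *)
definition numerical_radius :: "('a::chilbert_space \<Rightarrow>\<^sub>L 'a) \<Rightarrow> real"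
  where "numerical_radius T =
    Sup (insert 0 {cmod (cinner (blinfun_apply T x) x) | x. norm x = 1})"

(* The complex numbers c such that c I - T has no inverse in B(H). *)
definition spectrum_op :: "('a::chilbert_space \<Rightarrow>\<^sub>L 'a) \<Rightarrow> complex set"
  where "spectrum_op T = {c. \<not> (\<exists>S\<in>bounded_ops. \<forall>x.
    blinfun_apply S (c *\<^sub>C x - blinfun_apply T x) = x \<and>
    c *\<^sub>C blinfun_apply S x - blinfun_apply T (blinfun_apply S x) = x)}"

definition spectral_radius_op :: "('a::chilbert_space \<Rightarrow>\<^sub>L 'a) \<Rightarrow> real"
  where "spectral_radius_op T = Sup (insert 0 (cmod ` spectrum_op T))"

definition poly_op :: "real poly \<Rightarrow> ('a::chilbert_space \<Rightarrow>\<^sub>L 'a) \<Rightarrow> ('a \<Rightarrow>\<^sub>L 'a)"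
  where "poly_op p T =
    (\<Sum>i\<le>degree p. coeff p i *\<^sub>R (((\<lambda>S. T o\<^sub>L S) ^^ i) id_blinfun))"

(* Continuous functional calculus for a self-adjoint T (whose spectrum is real) and a real
   function f continuous on the spectrum: f(T) is the norm limit of p\<^sub>n(T) whenever the
   polynomials p\<^sub>n converge to f uniformly on the spectrum of T. *)
definition cfc :: "(real \<Rightarrow> real) \<Rightarrow> ('a::chilbert_space \<Rightarrow>\<^sub>L 'a) \<Rightarrow> ('a \<Rightarrow>\<^sub>L 'a)"
  where "cfc f T = (THE S. \<forall>p :: nat \<Rightarrow> real poly.
    uniform_limit {t. complex_of_real t \<in> spectrum_op T} (\<lambda>n. poly (p n)) f sequentially \<longrightarrow>
    (\<lambda>n. poly_op (p n) T) \<longlonglongrightarrow> S)"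

(* For positive T and s > 0. For s = 0 this would not be the identity, as 0 powr 0 = 0. *)
definition powr_op :: "('a::chilbert_space \<Rightarrow>\<^sub>L 'a) \<Rightarrow> real \<Rightarrow> ('a \<Rightarrow>\<^sub>L 'a)"
  where "powr_op T s = cfc (\<lambda>t. t powr s) T"

definition abs_op :: "('a::chilbert_space \<Rightarrow>\<^sub>L 'a) \<Rightarrow> ('a \<Rightarrow>\<^sub>L 'a)"
  where "abs_op T = powr_op (adj_op T o\<^sub>L T) (1/2)"

end

theory Submission
  imports Defs "HOL-Computational_Algebra.Fundamental_Theorem_Algebra"
begin

text \<open>
  A normal operator satisfies \<open>A\<^sup>* A = A A\<^sup>*\<close>, so \<open>\<bar>A\<bar>\<close> and \<open>\<bar>A\<^sup>*\<bar>\<close> are the same positive operator \<open>P\<close>, of norm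
  \<open>\<parallel>A\<parallel>\<close>. The norm on the right is then \<open>2 \<parallel>P\<^bsup>2r\<^esup>\<parallel>\<close>, and the spectral radius is that of the positive
  operator \<open>P\<^sup>r P\<^sup>r = P\<^bsup>2r\<^esup>\<close>, which equals its norm. The right-hand side is therefore
  \<open>\<parallel>P\<^bsup>2r\<^esup>\<parallel> = \<parallel>P\<parallel>\<^bsup>2r\<^esup> = \<parallel>A\<parallel>\<^bsup>2r\<^esup>\<close>, and the theorem says that the numerical radius of a normal operator is its norm.

  Three ingredients carry this. The first is the existence of adjoints, by the Riesz representation
  theorem (\<open>Riesz_representation_real\<close>).

  The second is a continuous functional calculus for positive operators. It rests on the fact that
  \<open>\<parallel>p(T)\<parallel>\<close> is a value of \<open>\<bar>p\<bar>\<close> on the spectrum of a self-adjoint \<open>T\<close> on a nonzero space (\<open>norm_poly_op_attained\<close>), proved with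
  approximate eigenvectors and a factorisation into linear factors. Uniformly convergent polynomials
  then give norm convergent operators (\<open>poly_op_tendsto_cfc\<close>), the calculus is multiplicative
  (\<open>cfc_mult\<close>), and on a nonzero space the norm of a positive operator is one of its approximate eigenvalues, which
  gives \<open>norm_powr_op\<close> and \<open>spectral_radius_positive_op\<close>.

  The third is the equality of numerical radius and norm (\<open>numerical_radius_normal\<close>). In place of
  the spectral theorem or the spectral radius formula, an averaging argument over roots of unity
  produces almost eigenvectors for an eigenvalue of modulus \<open>\<parallel>A\<parallel>\<close> (\<open>numerical_radius_paranormal\<close>).
\<close>

section \<open>Complex inner product spaces\<close>

lemma cinner_add_right: "cinner (x::'a::chilbert_space) (y + z) = cinner x y + cinner x z"
  by (metis cinner_add_left cinner_commute complex_cnj_add)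

lemma cinner_scaleC_right: "cinner (x::'a::chilbert_space) (c *\<^sub>C y) = cnj c * cinner x y"
  by (metis cinner_commute cinner_scaleC_left complex_cnj_mult)

text \<open>Homogeneity of the norm over the complex scalars follows from \<open>\<parallel>x\<parallel>\<^sup>2 = \<langle>x, x\<rangle>\<close>.\<close>

lemma norm_scaleC: "norm (c *\<^sub>C (x::'a::chilbert_space)) = cmod c * norm x"
proof -
  have "complex_of_real ((norm (c *\<^sub>C x))\<^sup>2) = complex_of_real ((cmod c * norm x)\<^sup>2)"
    unfolding cinner_self[symmetric] cinner_scaleC_left cinner_scaleC_right
    using complex_norm_square[of c] by (simp add: cinner_self power_mult_distrib mult.commute)
  then show ?thesis
    by (metis abs_of_nonneg mult_nonneg_nonneg norm_ge_zero of_real_eq_iff power2_eq_iff_nonneg)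
qed

lemma norm_add_square:
  "(norm (x + y :: 'a::chilbert_space))\<^sup>2 = (norm x)\<^sup>2 + 2 * Re (cinner x y) + (norm y)\<^sup>2"
proof -
  have "Re (cinner (x + y) (x + y)) = Re (cinner x x) + 2 * Re (cinner x y) + Re (cinner y y)"
    using cinner_commute[of y x] by (simp add: cinner_add_left cinner_add_right)
  then show ?thesis by (simp add: cinner_self)
qed

text \<open>The triangle inequality is already known for this norm, and squared it says
  \<open>Re \<langle>x, y\<rangle> \<le> \<parallel>x\<parallel> \<parallel>y\<parallel>\<close>; multiplying \<open>x\<close> by a phase turns the real part into the modulus.\<close>

lemma cinner_Cauchy_Schwarz: "cmod (cinner (x::'a::chilbert_space) y) \<le> norm x * norm y"
proof -
  have real: "Re (cinner u v) \<le> norm u * norm v" for u v :: 'a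
  proof -
    have "(norm (u + v))\<^sup>2 \<le> (norm u + norm v)\<^sup>2"
      by (intro power_mono norm_triangle_ineq) simp
    then show ?thesis by (simp add: norm_add_square power2_sum)
  qed
  define c where "c = (if cinner x y = 0 then 1 else cnj (sgn (cinner x y)))"
  have "cmod c \<le> 1" by (simp add: c_def norm_sgn)
  have "c * cinner x y = cmod (cinner x y)"
    by (simp add: c_def sgn_eq complex_norm_square[symmetric] power2_eq_square)
       (simp add: complex_norm_square[symmetric] mult.commute power2_eq_square)
  then have "cmod (cinner x y) = Re (cinner (c *\<^sub>C x) y)"
    by (simp add: cinner_scaleC_left)
  also have "\<dots> \<le> cmod c * norm x * norm y"
    using real[of "c *\<^sub>C x" y] by (simp add: norm_scaleC)
  also have "\<dots> \<le> norm x * norm y"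
    using \<open>cmod c \<le> 1\<close> by (simp add: mult_left_le_one_le mult.assoc)
  finally show ?thesis .
qed

interpretation cinner: bounded_bilinear "cinner :: 'a::chilbert_space \<Rightarrow> 'a \<Rightarrow> complex"
proof
  show "cinner (a *\<^sub>R x) y = a *\<^sub>R cinner x y" for a and x y :: 'a
    by (metis cinner_scaleC_left scaleC_of_real scaleR_conv_of_real)
  show "cinner x (a *\<^sub>R y) = a *\<^sub>R cinner x y" for a and x y :: 'a
    by (metis cinner_scaleC_right complex_cnj_complex_of_real scaleC_of_real scaleR_conv_of_real)
  show "\<exists>K. \<forall>x y :: 'a. norm (cinner x y) \<le> norm x * norm y * K"
    using cinner_Cauchy_Schwarz by (metis mult.right_neutral)
qed (simp_all add: cinner_add_left cinner_add_right)

interpretation scaleC: bounded_bilinear "scaleC :: complex \<Rightarrow> 'a::chilbert_space \<Rightarrow> 'a"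
proof
  show "(a *\<^sub>R c) *\<^sub>C x = a *\<^sub>R c *\<^sub>C x" for a c and x :: 'a
    by (metis scaleC_of_real scaleC_scaleC scaleR_conv_of_real)
  show "c *\<^sub>C a *\<^sub>R x = a *\<^sub>R c *\<^sub>C x" for a c and x :: 'a
    by (metis scaleC_of_real scaleC_scaleC mult.commute)
  show "\<exists>K. \<forall>c (x :: 'a). norm (c *\<^sub>C x) \<le> norm c * norm x * K"
    by (intro exI[of _ 1]) (simp add: norm_scaleC)
qed (simp_all add: scaleC_add_left scaleC_add_right)

lemma scaleC_one: "1 *\<^sub>C (x::'a::chilbert_space) = x"
  using scaleC_of_real[of 1 x] by simp

lemma norm_square_eq_cinner: "(norm (x::'a::chilbert_space))\<^sup>2 = Re (cinner x x)"
  by (simp add: cinner_self)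

lemma norm_diff_square:
  "(norm (x - y :: 'a::chilbert_space))\<^sup>2 = (norm x)\<^sup>2 - 2 * Re (cinner x y) + (norm y)\<^sup>2"
  using norm_add_square[of x "- y"] by (simp add: cinner.minus_right)

lemma cinner_ext:
  assumes "\<And>x. cinner (x::'a::chilbert_space) y = cinner x z"
  shows "y = z"
proof -
  have "cinner (y - z) (y - z) = 0"
    using assms by (simp add: cinner.diff_right)
  then show ?thesis by (simp add: cinner_self)
qed

section \<open>Representation of functionals and adjoints\<close>

text \<open>The representing vector is the minimiser of \<open>\<parallel>x\<parallel>\<^sup>2 - 2 f x\<close>, at which the derivative in
  every direction vanishes. By the parallelogram law every minimising sequence is Cauchy, so the
  minimum is attained in a complete space. Only real parts occur: the complex case is recovered
  below from complex linearity.\<close>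

lemma Riesz_representation_real:
  fixes f :: "'a::chilbert_space \<Rightarrow> real"
  assumes "bounded_linear f"
  obtains y where "\<And>x. f x = Re (cinner x y)"
proof -
  interpret f: bounded_linear f by fact
  obtain K where K: "\<And>x. \<bar>f x\<bar> \<le> norm x * K" "0 < K"
    using f.pos_bounded by (metis real_norm_def)
  define F where "F x = (norm x)\<^sup>2 - 2 * f x" for x
  have F_ge: "- K\<^sup>2 \<le> F x" for x
  proof -
    have "0 \<le> (norm x - K)\<^sup>2" by simp
    then show ?thesis using K(1)[of x] by (simp add: F_def power2_diff)
  qed
  define m where "m = Inf (range F)"
  have bdd: "bdd_below (range F)" using F_ge by (intro bdd_belowI[of _ "- K\<^sup>2"]) auto
  have m_le: "m \<le> F x" for x unfolding m_def by (intro cInf_lower bdd) auto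
  have "\<exists>x. F x < m + 1 / real (Suc n)" for n
    using cInf_lessD[of "range F" "m + 1 / real (Suc n)"] by (auto simp: m_def)
  then obtain X where X: "\<And>n. F (X n) < m + 1 / real (Suc n)" by metis
  (* the parallelogram law makes F uniformly convex *)
  have convex: "(norm (u - v))\<^sup>2 \<le> 2 * (F u - m) + 2 * (F v - m)" for u v
  proof -
    have "m \<le> F ((1/2) *\<^sub>R (u + v))" by (rule m_le)
    also have "\<dots> = (F u + F v) / 2 - (norm (u - v))\<^sup>2 / 4"
      unfolding F_def f.scaleR f.add norm_scaleR power_mult_distrib norm_add_square norm_diff_square
      by (simp add: power2_eq_square field_simps)
    finally have *: "m \<le> (F u + F v) / 2 - (norm (u - v))\<^sup>2 / 4" .
    have "N \<le> 2 * (a - m) + 2 * (b - m)" if "m \<le> (a + b) / 2 - N / 4" for a b N :: real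
      using that by (simp add: field_simps)
    from this[OF *] show ?thesis .
  qed
  have "Cauchy X"
  proof (rule metric_CauchyI)
    fix e :: real assume "0 < e"
    then obtain N where N: "4 / real (Suc N) < e\<^sup>2"
      using reals_Archimedean[of "e\<^sup>2 / 4"] by (auto simp: field_simps)
    have "dist (X i) (X j) < e" if "i \<ge> N" "j \<ge> N" for i j
    proof -
      have *: "F (X k) - m \<le> 1 / real (Suc N)" if "k \<ge> N" for k
      proof -
        have "1 / real (Suc k) \<le> 1 / real (Suc N)" using that by (simp add: frac_le)
        then show ?thesis using X[of k] by simp
      qed
      have "(norm (X i - X j))\<^sup>2 \<le> 4 / real (Suc N)"
        using convex[of "X i" "X j"] *[OF that(1)] *[OF that(2)] by simp
      also have "\<dots> < e\<^sup>2" by (rule N)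
      finally show ?thesis
        using \<open>0 < e\<close> by (simp add: dist_norm power_less_imp_less_base)
    qed
    then show "\<exists>N. \<forall>i\<ge>N. \<forall>j\<ge>N. dist (X i) (X j) < e" by blast
  qed
  then obtain y where y: "X \<longlonglongrightarrow> y" using Cauchy_convergent convergent_def by blast
  have "(\<lambda>n. F (X n)) \<longlonglongrightarrow> F y"
    unfolding F_def by (intro tendsto_intros f.tendsto y)
  moreover have "(\<lambda>n. m + 1 / real (Suc n)) \<longlonglongrightarrow> m + 0"
    by (intro tendsto_intros LIMSEQ_inverse_real_of_nat[unfolded inverse_eq_divide])
  ultimately have Fy: "F y \<le> m + 0"
    by (rule LIMSEQ_le) (use X in \<open>auto intro: less_imp_le\<close>)
  have "f x = Re (cinner x y)" for x
  proof -
    define d where "d = Re (cinner x y) - f x"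
    have quad: "0 \<le> 2 * t * d + t\<^sup>2 * (norm x)\<^sup>2" for t
    proof -
      have "F y \<le> F (y + t *\<^sub>R x)" using Fy m_le[of "y + t *\<^sub>R x"] by simp
      moreover have "F (y + t *\<^sub>R x) = F y + 2 * t * d + t\<^sup>2 * (norm x)\<^sup>2"
        using cinner_commute[of x y]
        unfolding F_def d_def norm_add_square f.add f.scaleR cinner.scaleR_right
        by (simp add: power_mult_distrib algebra_simps)
      ultimately show ?thesis by simp
    qed
    have "d = 0"
    proof (cases "x = 0")
      case True then show ?thesis by (simp add: d_def f.zero cinner.zero_left)
    next
      case False
      then have N: "0 < (norm x)\<^sup>2" by simp
      have "2 * (- d / N) * d + (- d / N)\<^sup>2 * N = - (d\<^sup>2 / N)" if "N > 0" for N :: real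
        using that by (simp add: field_simps power2_eq_square)
      then have "d\<^sup>2 / (norm x)\<^sup>2 \<le> 0" using quad[of "- d / (norm x)\<^sup>2"] N
        by (metis neg_0_le_iff_le)
      then show ?thesis using N by (simp add: divide_le_0_iff)
    qed
    then show ?thesis by (simp add: d_def)
  qed
  then show thesis by (rule that)
qed

lemma adjoint_unique:
  assumes "\<And>x y. cinner (blinfun_apply (T :: 'a::chilbert_space \<Rightarrow>\<^sub>L 'a) x) y = cinner x (blinfun_apply S y)"
  shows "adj_op T = S"
  unfolding adj_op_def
proof (rule the_equality)
  show "\<forall>x y. cinner (blinfun_apply T x) y = cinner x (blinfun_apply S y)" using assms by blast
  show "R = S" if "\<forall>x y. cinner (blinfun_apply T x) y = cinner x (blinfun_apply R y)" for R
    by (rule blinfun_eqI, rule cinner_ext) (rule trans[OF that[rule_format, symmetric] assms])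
qed

lemma cinner_adjoint:
  fixes T :: "'a::chilbert_space \<Rightarrow>\<^sub>L 'a"
  assumes "T \<in> bounded_ops"
  shows "cinner (blinfun_apply T x) y = cinner x (blinfun_apply (adj_op T) y)"
proof -
  have T: "blinfun_apply T (c *\<^sub>C x) = c *\<^sub>C blinfun_apply T x" for c x
    using assms by (simp add: bounded_ops_def)
  have "\<exists>z. \<forall>x. cinner (blinfun_apply T x) y = cinner x z" for y
  proof -
    have "bounded_linear (\<lambda>x. Re (cinner (blinfun_apply T x) y))"
      by (intro bounded_linear_compose[OF bounded_linear_Re]
          bounded_linear_compose[OF cinner.bounded_linear_left] blinfun.bounded_linear_right)
    then obtain z where z: "\<And>x. Re (cinner (blinfun_apply T x) y) = Re (cinner x z)"
      by (rule Riesz_representation_real) blast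
    (* a complex-linear functional is determined by its real part: Im w = - Re (i w) *)
    have "Im (cinner (blinfun_apply T x) y) = Im (cinner x z)" for x
      using z[of "\<i> *\<^sub>C x"] by (simp add: T cinner_scaleC_left)
    then show ?thesis using z by (metis complex_eqI)
  qed
  then obtain S where S: "\<And>x y. cinner (blinfun_apply T x) y = cinner x (S y)" by metis
  have "bounded_linear S"
  proof (rule bounded_linear_intro)
    show "S (y + z) = S y + S z" for y z
      by (rule cinner_ext) (simp add: S[symmetric] cinner.add_right)
    show "S (a *\<^sub>R y) = a *\<^sub>R S y" for a y
      by (rule cinner_ext) (simp add: S[symmetric] cinner.scaleR_right)
    show "norm (S y) \<le> norm y * norm T" for y
    proof (cases "S y = 0")
      case False
      have "norm (S y) * norm (S y) = cmod (cinner (S y) (S y))"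
        by (simp add: cinner_self power2_eq_square norm_mult)
      also have "\<dots> \<le> norm (blinfun_apply T (S y)) * norm y"
        using cinner_Cauchy_Schwarz[of "blinfun_apply T (S y)" y] S[of "S y" y] by simp
      also have "\<dots> \<le> norm T * norm (S y) * norm y"
        by (intro mult_right_mono norm_blinfun) simp
      finally show ?thesis using False by (simp add: mult.commute mult.left_commute)
    qed simp
  qed
  then have "blinfun_apply (Blinfun S) = S" by (rule bounded_linear_Blinfun_apply)
  then have "adj_op T = Blinfun S" using S by (intro adjoint_unique) simp
  then show ?thesis using S \<open>blinfun_apply (Blinfun S) = S\<close> by simp
qed

lemma cinner_adjoint':
  fixes T :: "'a::chilbert_space \<Rightarrow>\<^sub>L 'a"
  assumes "T \<in> bounded_ops"
  shows "cinner (blinfun_apply (adj_op T) x) y = cinner x (blinfun_apply T y)"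
proof -
  have "cinner (blinfun_apply (adj_op T) x) y = cnj (cinner y (blinfun_apply (adj_op T) x))"
    by (rule cinner_commute)
  also have "\<dots> = cnj (cinner (blinfun_apply T y) x)"
    by (simp only: cinner_adjoint[OF assms])
  also have "\<dots> = cinner x (blinfun_apply T y)"
    by (rule cinner_commute[symmetric])
  finally show ?thesis .
qed

lemma adj_op_adj_op: "T \<in> bounded_ops \<Longrightarrow> adj_op (adj_op T) = T"
  by (rule adjoint_unique) (rule cinner_adjoint')

section \<open>Spectra of positive operators\<close>

text \<open>The equation \<open>c x - T x = y\<close> is the fixed point equation of the contraction
  \<open>x \<mapsto> (y + T x) / c\<close>, so it has exactly one solution; this solution operator is the inverse.\<close>

lemma not_in_spectrum_if_norm_less:
  fixes T :: "'a::chilbert_space \<Rightarrow>\<^sub>L 'a"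
  assumes T: "T \<in> bounded_ops" and less: "norm T < cmod c"
  shows "c \<notin> spectrum_op T"
proof -
  define R where "R x = c *\<^sub>C x - blinfun_apply T x" for x
  define d where "d = cmod c - norm T"
  have c: "c \<noteq> 0" using less by auto
  have d: "0 < d" using less by (simp add: d_def)
  have R_add: "R (x + y) = R x + R y" and R_scaleR: "R (a *\<^sub>R x) = a *\<^sub>R R x"
    and R_diff: "R (x - y) = R x - R y" and R_scaleC: "R (b *\<^sub>C x) = b *\<^sub>C R x" for x y a b
    using T by (simp_all add: R_def bounded_ops_def scaleC.add_right scaleC.diff_right
        scaleC.scaleR_right blinfun.add_right blinfun.diff_right blinfun.scaleR_right
        scaleR_diff_right scaleC_scaleC mult.commute)
  have below: "d * norm x \<le> norm (R x)" for x
    using norm_triangle_ineq2[of "c *\<^sub>C x" "blinfun_apply T x"] norm_blinfun[of T x]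
    by (simp add: d_def R_def norm_scaleC algebra_simps)
  have "\<exists>x. R x = y" for y
  proof -
    define f where "f x = inverse c *\<^sub>C (y + blinfun_apply T x)" for x
    have "dist (f u) (f v) \<le> (norm T / cmod c) * dist u v" for u v
      using norm_blinfun[of T "u - v"] c
      by (simp add: f_def dist_norm scaleC.diff_right[symmetric] blinfun.diff_right[symmetric]
          norm_scaleC norm_inverse divide_simps) (simp add: norm_divide)
    then obtain x where "f x = x"
      using banach_fix_type[of "norm T / cmod c" f] less c by auto
    then have "c *\<^sub>C x = y + blinfun_apply T x"
      using c by (metis f_def right_inverse scaleC_one scaleC_scaleC)
    then show ?thesis by (intro exI[of _ x]) (simp add: R_def)
  qed
  then obtain S where RS: "\<And>y. R (S y) = y" by metis
  have inj: "x = y" if "R x = R y" for x y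
    using below[of "x - y"] that d by (simp add: R_diff mult_le_0_iff)
  have SR: "S (R x) = x" for x by (rule inj) (rule RS)
  have "bounded_linear S"
  proof (rule bounded_linear_intro)
    show "S (x + y) = S x + S y" for x y by (rule inj) (simp add: R_add RS)
    show "S (a *\<^sub>R x) = a *\<^sub>R S x" for a x by (rule inj) (simp add: R_scaleR RS)
    show "norm (S y) \<le> norm y * (1 / d)" for y
      using below[of "S y"] d by (simp add: RS field_simps)
  qed
  then have app: "blinfun_apply (Blinfun S) = S" by (rule bounded_linear_Blinfun_apply)
  have "S (b *\<^sub>C x) = b *\<^sub>C S x" for b x by (rule inj) (simp add: R_scaleC RS)
  then have "Blinfun S \<in> bounded_ops" by (simp add: bounded_ops_def app)
  moreover have "blinfun_apply (Blinfun S) (c *\<^sub>C x - blinfun_apply T x) = x"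
    "c *\<^sub>C blinfun_apply (Blinfun S) x - blinfun_apply T (blinfun_apply (Blinfun S) x) = x" for x
    using SR[of x] RS[of x] by (simp_all add: app R_def)
  ultimately show ?thesis unfolding spectrum_op_def by blast
qed

lemma bounded_below_if_not_in_spectrum:
  fixes T :: "'a::chilbert_space \<Rightarrow>\<^sub>L 'a"
  assumes "c \<notin> spectrum_op T"
  shows "\<exists>d>0. \<forall>x. d * norm x \<le> norm (blinfun_apply T x - c *\<^sub>C x)"
proof -
  obtain S where S: "\<And>x. blinfun_apply S (c *\<^sub>C x - blinfun_apply T x) = x"
    using assms by (auto simp: spectrum_op_def)
  have "1 / (norm S + 1) * norm x \<le> norm (blinfun_apply T x - c *\<^sub>C x)" for x
  proof -
    have "norm x \<le> norm S * norm (c *\<^sub>C x - blinfun_apply T x)"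
      using norm_blinfun[of S "c *\<^sub>C x - blinfun_apply T x"] by (simp add: S)
    also have "\<dots> \<le> (norm S + 1) * norm (blinfun_apply T x - c *\<^sub>C x)"
      by (simp add: norm_minus_commute algebra_simps)
    finally show ?thesis by (simp add: divide_le_eq mult.commute add_nonneg_pos)
  qed
  moreover have "0 < 1 / (norm S + 1)" by (simp add: add_nonneg_pos)
  ultimately show ?thesis by blast
qed

definition selfadjoint :: "('a::chilbert_space \<Rightarrow>\<^sub>L 'a) \<Rightarrow> bool"
  where "selfadjoint T \<longleftrightarrow> (\<forall>x y. cinner (blinfun_apply T x) y = cinner x (blinfun_apply T y))"

lemma selfadjointD:
  "selfadjoint T \<Longrightarrow> cinner (blinfun_apply T x) y = cinner x (blinfun_apply T y)"
  by (simp add: selfadjoint_def)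

definition positive_op :: "('a::chilbert_space \<Rightarrow>\<^sub>L 'a) \<Rightarrow> bool"
  where "positive_op T \<longleftrightarrow> selfadjoint T \<and> (\<forall>x. 0 \<le> Re (cinner (blinfun_apply T x) x))"

lemma bounded_ops_if_selfadjoint:
  assumes "selfadjoint T"
  shows "T \<in> bounded_ops"
proof -
  have "blinfun_apply T (c *\<^sub>C x) = c *\<^sub>C blinfun_apply T x" for c x
    by (rule cinner_ext)
      (simp add: selfadjointD[OF assms, symmetric] cinner_scaleC_right)
  then show ?thesis by (simp add: bounded_ops_def)
qed

lemma Im_cinner_selfadjoint:
  assumes "selfadjoint T"
  shows "Im (cinner (blinfun_apply T x) x) = 0"
proof -
  have "cinner (blinfun_apply T x) x = cnj (cinner (blinfun_apply T x) x)"
    using cinner_commute[of x "blinfun_apply T x"] selfadjointD[OF assms, of x x] by simp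
  then show ?thesis by (metis Im_complex_of_real complex_cnj_cancel_iff complex_cnj_cnj
      Reals_cnj_iff complex_is_Real_iff)
qed

text \<open>This is positivity of \<open>T\<close> at the vector \<open>x - T x / \<parallel>T\<parallel>\<close>, expanded.\<close>

lemma norm_positive_op_square_le:
  assumes "positive_op T"
  shows "(norm (blinfun_apply T x))\<^sup>2 \<le> norm T * Re (cinner (blinfun_apply T x) x)"
proof (cases "norm T = 0")
  case True
  then show ?thesis by simp
next
  case False
  then have M: "0 < norm T" by simp
  have sa: "selfadjoint T" using assms by (simp add: positive_op_def)
  define s where "s = inverse (norm T)"
  define y where "y = blinfun_apply T x"
  have "0 \<le> Re (cinner (blinfun_apply T (x - s *\<^sub>R y)) (x - s *\<^sub>R y))"
    using assms by (simp add: positive_op_def)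
  also have "\<dots> = Re (cinner y x) - 2 * s * (norm y)\<^sup>2 + s\<^sup>2 * Re (cinner (blinfun_apply T y) y)"
    using selfadjointD[OF sa, of y x]
    by (simp add: blinfun.diff_right blinfun.scaleR_right cinner.diff_left cinner.diff_right
        cinner.scaleR_left cinner.scaleR_right y_def[symmetric] norm_square_eq_cinner
        power2_eq_square[of s] algebra_simps)
  also have "Re (cinner (blinfun_apply T y) y) \<le> norm T * (norm y)\<^sup>2"
  proof -
    have "Re (cinner (blinfun_apply T y) y) \<le> norm (blinfun_apply T y) * norm y"
      using complex_Re_le_cmod cinner_Cauchy_Schwarz by (rule order_trans)
    also have "\<dots> \<le> norm T * norm y * norm y" by (intro mult_right_mono norm_blinfun) simp
    finally show ?thesis by (simp add: power2_eq_square)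
  qed
  finally have "0 \<le> Re (cinner y x) - 2 * s * (norm y)\<^sup>2 + s\<^sup>2 * (norm T * (norm y)\<^sup>2)"
    by (simp add: mult_left_mono)
  also have "\<dots> = Re (cinner y x) - (norm y)\<^sup>2 / norm T"
    using M by (simp add: s_def power2_eq_square field_simps)
  finally show ?thesis using M by (simp add: y_def field_simps)
qed

text \<open>By the previous bound \<open>T\<close> lies in the ball of radius \<open>\<parallel>T\<parallel> / 2\<close> around
  \<open>\<parallel>T\<parallel> / 2\<close>; so does its spectrum.\<close>

lemma real_spectrum_positive_op:
  fixes T :: "'a::chilbert_space \<Rightarrow>\<^sub>L 'a"
  assumes "positive_op T"
  shows "{t. complex_of_real t \<in> spectrum_op T} \<subseteq> {0..norm T}"
proof clarify
  fix t assume t: "complex_of_real t \<in> spectrum_op T"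
  have sa: "selfadjoint T" using assms by (simp add: positive_op_def)
  define m where "m = norm T / 2"
  define B where "B = T - m *\<^sub>R id_blinfun"
  have B: "blinfun_apply B x = blinfun_apply T x - m *\<^sub>R x" for x
    by (simp add: B_def blinfun.diff_left blinfun.scaleR_left)
  have "norm (blinfun_apply B x) \<le> m * norm x" for x
  proof -
    have "(norm (blinfun_apply B x))\<^sup>2
        = (norm (blinfun_apply T x))\<^sup>2 - norm T * Re (cinner (blinfun_apply T x) x) + (m * norm x)\<^sup>2"
      by (simp add: B norm_diff_square cinner.scaleR_right m_def power_mult_distrib)
    also have "\<dots> \<le> (m * norm x)\<^sup>2" using norm_positive_op_square_le[OF assms, of x] by simp
    finally show ?thesis by (rule power2_le_imp_le) (simp add: m_def)
  qed
  then have normB: "norm B \<le> m" by (intro norm_blinfun_bound) (auto simp: m_def)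
  have "B \<in> bounded_ops"
    using bounded_ops_if_selfadjoint[OF sa]
    by (simp add: bounded_ops_def B scaleC.diff_right scaleC.scaleR_right)
  moreover have "complex_of_real (t - m) \<in> spectrum_op B"
    using t by (simp add: spectrum_op_def B scaleC.diff_left scaleC_of_real algebra_simps)
  ultimately have "\<bar>t - m\<bar> \<le> m"
    using not_in_spectrum_if_norm_less[of B "complex_of_real (t - m)"] normB
    by (metis norm_of_real not_less order_trans)
  then show "t \<in> {0..norm T}"
    using abs_le_D1[of "t - m" m] abs_le_D2[of "t - m" m] by (simp add: m_def)
qed

section \<open>Polynomials of an operator\<close>

lemma poly_op_0 [simp]: "poly_op 0 T = 0"
  by (simp add: poly_op_def)

text \<open>Horner's scheme is the form of the definition that suits induction on polynomials.\<close>

lemma poly_op_pCons: "poly_op (pCons a p) T = a *\<^sub>R id_blinfun + (T o\<^sub>L poly_op p T)"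
proof (cases "p = 0")
  case True
  then show ?thesis by (simp add: poly_op_def bounded_bilinear.zero_right[OF bounded_bilinear_blinfun_compose])
next
  case False
  have "T o\<^sub>L poly_op p T = (\<Sum>i\<le>degree p. T o\<^sub>L (coeff p i *\<^sub>R (((\<lambda>S. T o\<^sub>L S) ^^ i) id_blinfun)))"
    unfolding poly_op_def by (rule bounded_bilinear.sum_right[OF bounded_bilinear_blinfun_compose])
  also have "\<dots> = (\<Sum>i\<le>degree p. coeff p i *\<^sub>R (((\<lambda>S. T o\<^sub>L S) ^^ Suc i) id_blinfun))"
    by (simp add: bounded_bilinear.scaleR_right[OF bounded_bilinear_blinfun_compose])
  finally show ?thesis
    using False by (simp add: poly_op_def sum.atMost_Suc_shift del: sum.atMost_Suc)
qed

lemma poly_op_const: "poly_op [:a:] T = a *\<^sub>R id_blinfun"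
  by (simp add: poly_op_pCons bounded_bilinear.zero_right[OF bounded_bilinear_blinfun_compose])

lemma poly_op_X: "poly_op [:0, 1:] T = T"
  by (simp add: poly_op_pCons blinfun_eqI blinfun.add_left)

lemma poly_op_add: "poly_op (p + q) T = poly_op p T + poly_op q T"
  by (induction p q rule: poly_induct2)
    (simp_all add: poly_op_pCons scaleR_add_left bounded_bilinear.add_right[OF bounded_bilinear_blinfun_compose])

lemma poly_op_smult: "poly_op (smult a p) T = a *\<^sub>R poly_op p T"
  by (induction p)
    (simp_all add: poly_op_pCons scaleR_add_right bounded_bilinear.scaleR_right[OF bounded_bilinear_blinfun_compose])

lemma poly_op_diff: "poly_op (p - q) T = poly_op p T - poly_op q T"
  using poly_op_add[of p "smult (-1) q" T] poly_op_smult[of "-1" q T] by simp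

lemma poly_op_mult: "poly_op (p * q) T = poly_op p T o\<^sub>L poly_op q T"
proof (induction p)
  case 0
  then show ?case by (simp add: bounded_bilinear.zero_left[OF bounded_bilinear_blinfun_compose])
next
  case (pCons a p)
  then show ?case
    by (simp add: poly_op_add poly_op_smult poly_op_pCons blinfun_eqI blinfun.add_left blinfun.scaleR_left)
qed

lemma selfadjoint_poly_op:
  assumes "selfadjoint T"
  shows "selfadjoint (poly_op p T)"
proof (induction p)
  case 0
  then show ?case by (simp add: selfadjoint_def cinner.zero_left cinner.zero_right)
next
  case (pCons a p)
  have comm: "blinfun_apply T (blinfun_apply (poly_op p T) x) = blinfun_apply (poly_op p T) (blinfun_apply T x)" for x
  proof -
    have "T o\<^sub>L poly_op p T = poly_op p T o\<^sub>L T"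
      using poly_op_mult[of "[:0, 1:]" p T] poly_op_mult[of p "[:0, 1:]" T] by (simp only: poly_op_X mult.commute)
    then show ?thesis by (metis blinfun_apply_blinfun_compose)
  qed
  then show ?case
    using pCons.IH assms unfolding selfadjoint_def
    by (simp add: poly_op_pCons blinfun.add_left blinfun.scaleR_left cinner.add_left
        cinner.add_right cinner.scaleR_left cinner.scaleR_right)
qed

text \<open>Factoring a real polynomial into linear factors needs complex coefficients, and the bounded
  operators form only a real vector space here. The complex polynomial therefore acts on vectors,
  by Horner's scheme.\<close>

definition poly_act :: "complex poly \<Rightarrow> ('a::chilbert_space \<Rightarrow>\<^sub>L 'a) \<Rightarrow> 'a \<Rightarrow> 'a"
  where "poly_act p T x = fold_coeffs (\<lambda>a y. a *\<^sub>C x + blinfun_apply T y) p 0"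

lemma poly_act_0 [simp]: "poly_act 0 T x = 0"
  by (simp add: poly_act_def)

lemma poly_act_pCons: "poly_act (pCons a p) T x = a *\<^sub>C x + blinfun_apply T (poly_act p T x)"
  by (cases "a = 0 \<and> p = 0") (auto simp: poly_act_def scaleC.zero_left blinfun.zero_right)

lemma poly_act_add: "poly_act (p + q) T x = poly_act p T x + poly_act q T x"
  by (induction p q rule: poly_induct2)
    (simp_all add: poly_act_pCons scaleC.add_left blinfun.add_right)

lemma poly_act_smult:
  assumes "T \<in> bounded_ops"
  shows "poly_act (smult a p) T x = a *\<^sub>C poly_act p T x"
  using assms by (induction p)
    (simp_all add: poly_act_pCons scaleC.add_right scaleC.zero_right scaleC_scaleC bounded_ops_def)

lemma poly_act_linear_factor:
  assumes "T \<in> bounded_ops"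
  shows "poly_act ([:- z, 1:] * q) T x = blinfun_apply T (poly_act q T x) - z *\<^sub>C poly_act q T x"
  by (simp add: poly_act_add poly_act_smult[OF assms] poly_act_pCons scaleC.zero_left
      scaleC.minus_left del: smult_minus_left)

lemma poly_act_of_real: "poly_act (map_poly of_real p) T x = blinfun_apply (poly_op p T) x"
  by (induction p) (simp_all add: map_poly_pCons poly_act_pCons poly_op_pCons scaleC_of_real
      blinfun.add_left blinfun.scaleR_left)

text \<open>By the fundamental theorem of algebra \<open>q(T)\<close> is a product of factors \<open>T - z\<close> with \<open>z\<close> a root
  of \<open>q\<close>, and a product of operators that are bounded below is bounded below.\<close>

lemma poly_act_bounded_below:
  fixes T :: "'a::chilbert_space \<Rightarrow>\<^sub>L 'a"
  assumes T: "T \<in> bounded_ops" and "q \<noteq> 0"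
    and roots: "\<And>z. poly q z = 0 \<Longrightarrow> \<exists>d>0. \<forall>x. d * norm x \<le> norm (blinfun_apply T x - z *\<^sub>C x)"
  shows "\<exists>d>0. \<forall>x. d * norm x \<le> norm (poly_act q T x)"
  using \<open>q \<noteq> 0\<close> roots
proof (induction "degree q" arbitrary: q)
  case 0
  then obtain a where "q = [:a:]" "a \<noteq> 0" by (metis degree_eq_zeroE pCons_eq_0_iff)
  then show ?case
    by (intro exI[of _ "cmod a"]) (simp add: poly_act_pCons blinfun.zero_right norm_scaleC)
next
  case (Suc n)
  have "0 < degree q" using Suc.hyps(2) by simp
  then obtain z where z: "poly q z = 0" using alg_closed_imp_poly_has_root by blast
  then obtain p where q: "q = [:- z, 1:] * p" by (metis dvdE poly_eq_0_iff_dvd)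
  have p: "p \<noteq> 0" using Suc.prems(1) q by auto
  have "degree q = Suc (degree p)" unfolding q using p by (subst degree_mult_eq) auto
  then have "n = degree p" using Suc.hyps(2) by simp
  then obtain d where d: "0 < d" "\<And>x. d * norm x \<le> norm (poly_act p T x)"
    using Suc.hyps(1)[of p] Suc.prems(2) p unfolding q by auto
  obtain e where e: "0 < e" "\<And>x. e * norm x \<le> norm (blinfun_apply T x - z *\<^sub>C x)"
    using Suc.prems(2)[OF z] by blast
  have "e * d * norm x \<le> norm (poly_act q T x)" for x
  proof -
    have "e * (d * norm x) \<le> e * norm (poly_act p T x)" using d e(1) by (intro mult_left_mono) auto
    also have "\<dots> \<le> norm (poly_act q T x)" unfolding q poly_act_linear_factor[OF T] by (rule e(2))
    finally show ?thesis by (simp add: mult.assoc)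
  qed
  then show ?case using d(1) e(1) by (intro exI[of _ "e * d"]) auto
qed

section \<open>Norms of polynomials of a self-adjoint operator\<close>

text \<open>Approximate eigenvalues are easier to handle than the spectrum, because only lower bounds
  and no inverses are involved; for self-adjoint operators they suffice to compute norms.\<close>

definition approx_eigenvalue :: "('a::chilbert_space \<Rightarrow>\<^sub>L 'a) \<Rightarrow> complex \<Rightarrow> bool"
  where "approx_eigenvalue T c \<longleftrightarrow> \<not> (\<exists>d>0. \<forall>x. d * norm x \<le> norm (blinfun_apply T x - c *\<^sub>C x))"

lemma approx_eigenvalue_in_spectrum: "approx_eigenvalue T c \<Longrightarrow> c \<in> spectrum_op T"
  using bounded_below_if_not_in_spectrum unfolding approx_eigenvalue_def by blast

text \<open>The imaginary part of \<open>\<langle>T x - c x, x\<rangle>\<close> is \<open>- Im c \<parallel>x\<parallel>\<^sup>2\<close>, so a nonreal \<open>c\<close> makes \<open>T - c\<close> bounded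
  below.\<close>

lemma approx_eigenvalue_selfadjoint_real:
  assumes sa: "selfadjoint T" and c: "approx_eigenvalue T c"
  shows "c = complex_of_real (Re c)"
proof (rule ccontr)
  assume "c \<noteq> complex_of_real (Re c)"
  then have "0 < \<bar>Im c\<bar>" by (auto simp: complex_eq_iff)
  moreover have "\<bar>Im c\<bar> * norm x \<le> norm (blinfun_apply T x - c *\<^sub>C x)" for x
  proof -
    have "Im (cinner (blinfun_apply T x - c *\<^sub>C x) x) = - Im c * (norm x)\<^sup>2"
      by (simp add: cinner.diff_left cinner_scaleC_left Im_cinner_selfadjoint[OF sa] cinner_self)
    then have "\<bar>Im c\<bar> * (norm x)\<^sup>2 = \<bar>Im (cinner (blinfun_apply T x - c *\<^sub>C x) x)\<bar>"
      by (simp add: abs_mult)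
    also have "\<dots> \<le> norm (blinfun_apply T x - c *\<^sub>C x) * norm x"
      using abs_Im_le_cmod cinner_Cauchy_Schwarz by (rule order_trans)
    finally show ?thesis by (cases "x = 0") (simp_all add: power2_eq_square)
  qed
  ultimately show False using c unfolding approx_eigenvalue_def by blast
qed

text \<open>On vectors where \<open>\<parallel>T x\<parallel>\<close> almost attains the norm, \<open>T\<^sup>2 x\<close> is close to \<open>\<parallel>T\<parallel>\<^sup>2 x\<close>, since
  \<open>\<parallel>T\<^sup>2 x - M\<^sup>2 x\<parallel>\<^sup>2 = \<parallel>T\<^sup>2 x\<parallel>\<^sup>2 - 2 M\<^sup>2 \<parallel>T x\<parallel>\<^sup>2 + M\<^sup>4 \<parallel>x\<parallel>\<^sup>2\<close> for \<open>M = \<parallel>T\<parallel>\<close>. Read backwards, a lower bound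
  \<open>d\<close> for \<open>T\<^sup>2 - M\<^sup>2\<close> would give \<open>\<parallel>T\<parallel>\<^sup>2 \<le> M\<^sup>2 - (d / M)\<^sup>2\<close>.\<close>

lemma selfadjoint_square_not_bounded_below:
  fixes T :: "'a::chilbert_space \<Rightarrow>\<^sub>L 'a"
  assumes sa: "selfadjoint T" and x0: "x0 \<noteq> (0::'a)" and "0 < d"
    and below: "\<And>x. d * norm x \<le> norm (blinfun_apply T (blinfun_apply T x) - (norm T)\<^sup>2 *\<^sub>R x)"
  shows False
proof -
  define M where "M = norm T"
  have key: "d\<^sup>2 * (norm x)\<^sup>2 + M\<^sup>2 * (norm (blinfun_apply T x))\<^sup>2 \<le> M\<^sup>2 * M\<^sup>2 * (norm x)\<^sup>2" for x
  proof -
    let ?y = "blinfun_apply T x"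
    have "(d * norm x)\<^sup>2 \<le> (norm (blinfun_apply T ?y - M\<^sup>2 *\<^sub>R x))\<^sup>2"
      using below[of x] \<open>0 < d\<close> unfolding M_def by (intro power_mono) auto
    also have "\<dots> = (norm (blinfun_apply T ?y))\<^sup>2 - 2 * M\<^sup>2 * (norm ?y)\<^sup>2 + M\<^sup>2 * M\<^sup>2 * (norm x)\<^sup>2"
      using selfadjointD[OF sa, of ?y x]
      by (simp add: norm_diff_square cinner.scaleR_right norm_square_eq_cinner[of ?y] power_mult_distrib power2_eq_square[of "M\<^sup>2"])
    also have "(norm (blinfun_apply T ?y))\<^sup>2 \<le> (M * norm ?y)\<^sup>2"
      unfolding M_def by (intro power_mono norm_blinfun) simp
    finally show ?thesis by (simp add: power_mult_distrib)
  qed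
  have M: "0 < M"
  proof (rule ccontr)
    assume "\<not> 0 < M"
    then have "M = 0" by (simp add: M_def)
    then show False using key[of x0] x0 \<open>0 < d\<close> by (simp add: mult_le_0_iff)
  qed
  define b where "b = M\<^sup>2 - (d / M)\<^sup>2"
  have key': "(norm (blinfun_apply T x))\<^sup>2 \<le> b * (norm x)\<^sup>2" for x
  proof -
    have "a \<le> (m - e / m) * n" if "e * n + m * a \<le> m * m * n" "0 < m" for a m e n :: real
      using that by (simp add: field_simps)
    from this[OF key[of x]] show ?thesis using M by (simp add: b_def power_divide)
  qed
  have "0 \<le> b * (norm x0)\<^sup>2" using key'[of x0] by (rule order_trans[rotated]) simp
  then have b: "0 \<le> b" using x0 by (simp add: zero_le_mult_iff)
  have "norm (blinfun_apply T x) \<le> sqrt b * norm x" for x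
    using real_sqrt_le_mono[OF key'[of x]] by (simp add: real_sqrt_mult)
  then have "M \<le> sqrt b" unfolding M_def using b by (intro norm_blinfun_bound) auto
  then have "M\<^sup>2 \<le> b" using M b by (metis less_imp_le power_mono real_sqrt_pow2)
  moreover have "0 < (d / M)\<^sup>2" using M \<open>0 < d\<close> by simp
  ultimately show False by (simp add: b_def)
qed

text \<open>Spectral mapping without inverses: for \<open>B = p(T)\<close> the operator \<open>B\<^sup>2 - \<parallel>B\<parallel>\<^sup>2\<close> is not bounded
  below, and it is the value at \<open>T\<close> of the polynomial \<open>p\<^sup>2 - \<parallel>B\<parallel>\<^sup>2\<close>. Hence one of the roots of that
  polynomial is an approximate eigenvalue of \<open>T\<close>, and at a root \<open>\<bar>p\<bar> = \<parallel>B\<parallel>\<close>.\<close>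

lemma norm_poly_op_attained:
  fixes T :: "'a::chilbert_space \<Rightarrow>\<^sub>L 'a"
  assumes sa: "selfadjoint T" and x0: "x0 \<noteq> (0::'a)"
  shows "\<exists>t. approx_eigenvalue T (complex_of_real t) \<and> \<bar>poly p t\<bar> = norm (poly_op p T)"
proof -
  have nonconst: "\<exists>t. approx_eigenvalue T (complex_of_real t) \<and> (poly p t)\<^sup>2 = (norm (poly_op p T))\<^sup>2"
    if "p * p \<noteq> [:(norm (poly_op p T))\<^sup>2:]" for p
  proof -
    define B where "B = poly_op p T"
    define q where "q = p * p - [:(norm B)\<^sup>2:]"
    have act: "poly_act (map_poly of_real q) T x = blinfun_apply B (blinfun_apply B x) - (norm B)\<^sup>2 *\<^sub>R x" for x
      unfolding poly_act_of_real q_def poly_op_diff poly_op_mult poly_op_const B_def[symmetric]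
      by (simp add: blinfun.diff_left blinfun.scaleR_left)
    have "map_poly complex_of_real q \<noteq> 0"
      using that by (subst map_poly_eq_0_iff) (auto simp: q_def B_def)
    moreover have "\<not> (\<exists>d>0. \<forall>x. d * norm x \<le> norm (poly_act (map_poly of_real q) T x))"
      using selfadjoint_square_not_bounded_below[OF selfadjoint_poly_op[OF sa] x0]
      unfolding act B_def by blast
    ultimately obtain z where z: "poly (map_poly of_real q) z = 0" "approx_eigenvalue T z"
      using poly_act_bounded_below[OF bounded_ops_if_selfadjoint[OF sa]]
      unfolding approx_eigenvalue_def by blast
    define t where "t = Re z"
    have zt: "z = complex_of_real t"
      unfolding t_def by (rule approx_eigenvalue_selfadjoint_real[OF sa z(2)])
    have "poly (map_poly of_real q) (complex_of_real t) = complex_of_real (poly q t)"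
      by (induction q) (simp_all add: map_poly_pCons)
    then have "poly q t = 0" using z(1) by (simp add: zt)
    then show ?thesis using z(2) by (auto simp: zt q_def B_def power2_eq_square)
  qed
  have "\<exists>t. approx_eigenvalue T (complex_of_real t) \<and> (poly p t)\<^sup>2 = (norm (poly_op p T))\<^sup>2"
  proof (cases "p * p = [:(norm (poly_op p T))\<^sup>2:]")
    case True
    (* then p is constant, and any approximate eigenvalue will do *)
    obtain t where "approx_eigenvalue T (complex_of_real t)"
      using nonconst[of "[:0, 1:]"] by auto
    moreover have "poly (p * p) t = (norm (poly_op p T))\<^sup>2" by (simp add: True)
    ultimately show ?thesis by (auto simp: power2_eq_square)
  qed (rule nonconst)
  then show ?thesis by (metis norm_ge_zero power2_abs abs_ge_zero power2_eq_iff_nonneg)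
qed

text \<open>This bound is what makes the functional calculus well defined: uniform convergence of
  polynomials on the spectrum forces norm convergence of the operators. On the zero space the
  spectrum is empty and the hypothesis on \<open>p\<close> vacuous, whence the condition \<open>0 \<le> b\<close>.\<close>

lemma norm_poly_op_le:
  fixes T :: "'a::chilbert_space \<Rightarrow>\<^sub>L 'a"
  assumes sa: "selfadjoint T" and "0 \<le> b"
    and b: "\<And>t. complex_of_real t \<in> spectrum_op T \<Longrightarrow> \<bar>poly p t\<bar> \<le> b"
  shows "norm (poly_op p T) \<le> b"
proof (cases "\<exists>x0::'a. x0 \<noteq> 0")
  case True
  then show ?thesis
    using norm_poly_op_attained[OF sa] b approx_eigenvalue_in_spectrum by metis
next
  case False
  then have "poly_op p T = 0" by (intro blinfun_eqI) auto
  then show ?thesis using \<open>0 \<le> b\<close> by simp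
qed

text \<open>If \<open>\<bar>p(t)\<bar> > \<parallel>p(T)\<parallel>\<close>, then \<open>p(T) - p(t)\<close> is bounded below; as \<open>T - t\<close> divides it, \<open>T - t\<close> is bounded
  below too.\<close>

lemma poly_approx_eigenvalue_le:
  fixes T :: "'a::chilbert_space \<Rightarrow>\<^sub>L 'a"
  assumes t: "approx_eigenvalue T (complex_of_real t)"
  shows "\<bar>poly p t\<bar> \<le> norm (poly_op p T)"
proof (rule ccontr)
  assume "\<not> ?thesis"
  then have d: "0 < \<bar>poly p t\<bar> - norm (poly_op p T)" (is "0 < ?d") by simp
  obtain q where q: "p - [:poly p t:] = q * [:- t, 1:]"
    using poly_eq_0_iff_dvd[of "p - [:poly p t:]" t] by (auto simp: mult.commute elim: dvdE)
  define C where "C = norm (poly_op q T) + 1"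
  have C: "0 < C" by (simp add: C_def add_nonneg_pos)
  have "?d / C * norm x \<le> norm (blinfun_apply T x - complex_of_real t *\<^sub>C x)" for x
  proof -
    have lin: "poly_op [:- t, 1:] T = T - t *\<^sub>R id_blinfun"
      by (rule blinfun_eqI) (simp add: poly_op_pCons blinfun.add_left blinfun.diff_left blinfun.scaleR_left
          blinfun.minus_left)
    have "poly_op p T - poly p t *\<^sub>R id_blinfun = poly_op q T o\<^sub>L (T - t *\<^sub>R id_blinfun)"
      using arg_cong[OF q, of "\<lambda>p. poly_op p T"]
      by (simp only: poly_op_diff poly_op_const poly_op_mult lin)
    from arg_cong[OF this, of "\<lambda>S. blinfun_apply S x"]
    have eq: "blinfun_apply (poly_op p T) x - poly p t *\<^sub>R x
        = blinfun_apply (poly_op q T) (blinfun_apply T x - t *\<^sub>R x)"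
      by (simp add: blinfun.diff_left blinfun.scaleR_left)
    have "?d * norm x \<le> \<bar>poly p t\<bar> * norm x - norm (blinfun_apply (poly_op p T) x)"
      using norm_blinfun[of "poly_op p T" x] by (simp add: left_diff_distrib)
    also have "\<dots> \<le> norm (blinfun_apply (poly_op p T) x - poly p t *\<^sub>R x)"
      using norm_triangle_ineq2[of "poly p t *\<^sub>R x" "blinfun_apply (poly_op p T) x"]
      by (simp add: norm_minus_commute)
    also have "\<dots> \<le> norm (poly_op q T) * norm (blinfun_apply T x - t *\<^sub>R x)"
      unfolding eq by (rule norm_blinfun)
    also have "\<dots> \<le> C * norm (blinfun_apply T x - t *\<^sub>R x)"
      by (intro mult_right_mono) (auto simp: C_def)
    finally show ?thesis using C by (simp add: scaleC_of_real divide_le_eq mult.commute)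
  qed
  moreover have "0 < ?d / C" using d C by simp
  ultimately show False using t unfolding approx_eigenvalue_def by blast
qed

lemma approx_eigenvalue_norm:
  fixes T :: "'a::chilbert_space \<Rightarrow>\<^sub>L 'a"
  assumes "positive_op T" and "x0 \<noteq> (0::'a)"
  shows "approx_eigenvalue T (complex_of_real (norm T))"
proof -
  have sa: "selfadjoint T" using assms(1) by (simp add: positive_op_def)
  obtain t where t: "approx_eigenvalue T (complex_of_real t)" "\<bar>t\<bar> = norm T"
    using norm_poly_op_attained[OF sa assms(2), of "[:0, 1:]"] by (auto simp: poly_op_X)
  have "0 \<le> t"
    using approx_eigenvalue_in_spectrum[OF t(1)] real_spectrum_positive_op[OF assms(1)] by auto
  then show ?thesis using t by simp
qed

lemma spectral_radius_positive_op:
  fixes T :: "'a::chilbert_space \<Rightarrow>\<^sub>L 'a"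
  assumes "positive_op T"
  shows "spectral_radius_op T = norm T"
  unfolding spectral_radius_op_def
proof (rule cSup_eq_maximum)
  have T: "T \<in> bounded_ops"
    using assms by (auto simp: positive_op_def intro: bounded_ops_if_selfadjoint)
  show "norm T \<in> insert 0 (cmod ` spectrum_op T)"
  proof (cases "\<exists>x0::'a. x0 \<noteq> 0")
    case True
    then have "complex_of_real (norm T) \<in> spectrum_op T"
      using approx_eigenvalue_norm[OF assms] approx_eigenvalue_in_spectrum by blast
    then have "cmod (complex_of_real (norm T)) \<in> cmod ` spectrum_op T" by (rule imageI)
    then show ?thesis by simp
  next
    case False
    then have "T = 0" by (intro blinfun_eqI) auto
    then show ?thesis by simp
  qed
  show "s \<le> norm T" if "s \<in> insert 0 (cmod ` spectrum_op T)" for s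
    using that not_in_spectrum_if_norm_less[OF T] by force
qed

section \<open>Continuous functional calculus\<close>

lemma uniform_polynomial_approximation:
  fixes f :: "real \<Rightarrow> real"
  assumes "continuous_on {a..b} f"
  obtains p :: "nat \<Rightarrow> real poly"
  where "uniform_limit {a..b} (\<lambda>n. poly (p n)) f sequentially"
proof -
  have "\<exists>p. \<forall>x\<in>{a..b}. \<bar>f x - poly p x\<bar> < 1 / real (Suc n)" for n
  proof -
    obtain g where g: "real_polynomial_function g" "\<And>x. x \<in> {a..b} \<Longrightarrow> \<bar>f x - g x\<bar> < 1 / real (Suc n)"
      using Stone_Weierstrass_real_polynomial_function[OF compact_Icc assms, of "1 / real (Suc n)"] by auto
    obtain c m where "g = (\<lambda>x. \<Sum>i\<le>m. c i * x ^ i)"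
      using g(1) real_polynomial_function_iff_sum by blast
    then have "g x = poly (\<Sum>i\<le>m. monom (c i) i) x" for x
      by (simp add: poly_sum poly_monom)
    then show ?thesis using g(2) by metis
  qed
  then obtain p where p: "\<And>n x. x \<in> {a..b} \<Longrightarrow> \<bar>f x - poly (p n) x\<bar> < 1 / real (Suc n)" by metis
  have "uniform_limit {a..b} (\<lambda>n. poly (p n)) f sequentially"
  proof (rule uniform_limitI)
    fix e :: real assume "0 < e"
    then obtain N where N: "1 / real (Suc N) < e" using reals_Archimedean by (auto simp: inverse_eq_divide)
    have "dist (poly (p n) x) (f x) < e" if "n \<ge> N" "x \<in> {a..b}" for n x
    proof -
      have "1 / real (Suc n) \<le> 1 / real (Suc N)" using that by (simp add: frac_le)
      then show ?thesis using p[OF that(2), of n] N by (simp add: dist_real_def abs_minus_commute)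
    qed
    then show "\<forall>\<^sub>F n in sequentially. \<forall>x\<in>{a..b}. dist (poly (p n) x) (f x) < e"
      unfolding eventually_sequentially by blast
  qed
  then show thesis by (rule that)
qed

lemma poly_op_eventually_close:
  fixes T :: "'a::chilbert_space \<Rightarrow>\<^sub>L 'a"
  assumes sa: "selfadjoint T"
    and p: "uniform_limit {t. complex_of_real t \<in> spectrum_op T} (\<lambda>n. poly (p n)) f sequentially"
    and q: "uniform_limit {t. complex_of_real t \<in> spectrum_op T} (\<lambda>n. poly (q n)) f sequentially"
    and "0 < e"
  shows "\<exists>N. \<forall>m\<ge>N. \<forall>n\<ge>N. norm (poly_op (p m) T - poly_op (q n) T) < e"
proof -
  let ?K = "{t. complex_of_real t \<in> spectrum_op T}"
  have e: "0 < e / 3" using \<open>0 < e\<close> by simp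
  obtain N1 where N1: "\<And>n t. n \<ge> N1 \<Longrightarrow> t \<in> ?K \<Longrightarrow> dist (poly (p n) t) (f t) < e / 3"
    using uniform_limitD[OF p e] unfolding eventually_sequentially by blast
  obtain N2 where N2: "\<And>n t. n \<ge> N2 \<Longrightarrow> t \<in> ?K \<Longrightarrow> dist (poly (q n) t) (f t) < e / 3"
    using uniform_limitD[OF q e] unfolding eventually_sequentially by blast
  have "norm (poly_op (p m) T - poly_op (q n) T) < e" if "m \<ge> max N1 N2" "n \<ge> max N1 N2" for m n
  proof -
    have "norm (poly_op (p m - q n) T) \<le> 2 * e / 3"
    proof (rule norm_poly_op_le[OF sa])
      fix t assume "complex_of_real t \<in> spectrum_op T"
      then have "\<bar>poly (p m) t - f t\<bar> < e / 3" "\<bar>poly (q n) t - f t\<bar> < e / 3"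
        using N1[of m t] N2[of n t] that by (auto simp: dist_real_def)
      then show "\<bar>poly (p m - q n) t\<bar> \<le> 2 * e / 3"
        unfolding poly_diff by linarith
    qed (use \<open>0 < e\<close> in simp)
    then show ?thesis using \<open>0 < e\<close> by (simp add: poly_op_diff)
  qed
  then show ?thesis by blast
qed

text \<open>The operators along one approximating sequence form a Cauchy sequence, and any other
  approximating sequence stays asymptotically equal to it. So the common limit in the definition of
  the functional calculus exists, and it is unique since at least one approximating sequence exists.\<close>

lemma poly_op_tendsto_cfc:
  fixes T :: "'a::chilbert_space \<Rightarrow>\<^sub>L 'a"
  assumes T: "positive_op T" and f: "continuous_on {0..norm T} f"
    and p: "uniform_limit {t. complex_of_real t \<in> spectrum_op T} (\<lambda>n. poly (p n)) f sequentially"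
  shows "(\<lambda>n. poly_op (p n) T) \<longlonglongrightarrow> cfc f T"
proof -
  let ?K = "{t. complex_of_real t \<in> spectrum_op T}"
  have sa: "selfadjoint T" using T by (simp add: positive_op_def)
  obtain q where "uniform_limit {0..norm T} (\<lambda>n. poly (q n)) f sequentially"
    using uniform_polynomial_approximation[OF f] by blast
  then have q: "uniform_limit ?K (\<lambda>n. poly (q n)) f sequentially"
    by (rule uniform_limit_on_subset) (rule real_spectrum_positive_op[OF T])
  have "Cauchy (\<lambda>n. poly_op (q n) T)"
    by (rule metric_CauchyI) (metis dist_norm poly_op_eventually_close[OF sa q q])
  then obtain S where S: "(\<lambda>n. poly_op (q n) T) \<longlonglongrightarrow> S"
    using Cauchy_convergent convergent_def by blast
  have lim: "(\<lambda>n. poly_op (p n) T) \<longlonglongrightarrow> S"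
    if p: "uniform_limit ?K (\<lambda>n. poly (p n)) f sequentially" for p
  proof -
    have "(\<lambda>n. poly_op (p n) T - poly_op (q n) T) \<longlonglongrightarrow> 0"
      by (rule LIMSEQ_I) (metis diff_zero poly_op_eventually_close[OF sa p q])
    from tendsto_add[OF this S] show ?thesis by simp
  qed
  have "cfc f T = S"
    unfolding cfc_def using lim q by (intro the_equality) (blast intro: LIMSEQ_unique)+
  then show ?thesis using lim[OF p] by simp
qed

lemma cfc_approximation:
  assumes T: "positive_op T" and f: "continuous_on {0..norm T} f"
  obtains p where "uniform_limit {0..norm T} (\<lambda>n. poly (p n)) f sequentially"
    and "(\<lambda>n. poly_op (p n) T) \<longlonglongrightarrow> cfc f T"
proof -
  obtain p where p: "uniform_limit {0..norm T} (\<lambda>n. poly (p n)) f sequentially"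
    using uniform_polynomial_approximation[OF f] by blast
  then have "(\<lambda>n. poly_op (p n) T) \<longlonglongrightarrow> cfc f T"
    by (intro poly_op_tendsto_cfc T f)
      (erule uniform_limit_on_subset, rule real_spectrum_positive_op[OF T])
  with p show thesis by (rule that)
qed

text \<open>The function \<open>h\<close> is a separate variable so that it only has to agree with the product on the
  interval that carries the spectrum.\<close>

lemma cfc_mult:
  assumes T: "positive_op T"
    and f: "continuous_on {0..norm T} f" and g: "continuous_on {0..norm T} g"
    and h: "\<And>t. t \<in> {0..norm T} \<Longrightarrow> h t = f t * g t"
  shows "cfc h T = cfc f T o\<^sub>L cfc g T"
proof -
  obtain p where p: "uniform_limit {0..norm T} (\<lambda>n. poly (p n)) f sequentially"
      "(\<lambda>n. poly_op (p n) T) \<longlonglongrightarrow> cfc f T"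
    using cfc_approximation[OF T f] by blast
  obtain q where q: "uniform_limit {0..norm T} (\<lambda>n. poly (q n)) g sequentially"
      "(\<lambda>n. poly_op (q n) T) \<longlonglongrightarrow> cfc g T"
    using cfc_approximation[OF T g] by blast
  have bdd: "bounded (f ` {0..norm T})" "bounded (g ` {0..norm T})"
    by (intro compact_imp_bounded compact_continuous_image f g compact_Icc)+
  have "uniform_limit {0..norm T} (\<lambda>n. poly (p n * q n)) (\<lambda>t. f t * g t) sequentially"
    using uniform_lim_mult[OF p(1) q(1) bdd] by (simp add: poly_mult[abs_def])
  then have "uniform_limit {0..norm T} (\<lambda>n. poly (p n * q n)) h sequentially"
    using h by (subst uniform_limit_cong'[where i = "\<lambda>t. f t * g t" and g = "\<lambda>n. poly (p n * q n)"]) auto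
  then have "uniform_limit {t. complex_of_real t \<in> spectrum_op T} (\<lambda>n. poly (p n * q n)) h sequentially"
    by (rule uniform_limit_on_subset) (rule real_spectrum_positive_op[OF T])
  moreover have "continuous_on {0..norm T} h"
    using continuous_on_mult[OF f g] h by (subst continuous_on_cong[OF refl]) auto
  ultimately have "(\<lambda>n. poly_op (p n * q n) T) \<longlonglongrightarrow> cfc h T"
    by (intro poly_op_tendsto_cfc T)
  moreover have "(\<lambda>n. poly_op (p n * q n) T) \<longlonglongrightarrow> (cfc f T o\<^sub>L cfc g T)"
    unfolding poly_op_mult
    by (intro bounded_bilinear.tendsto[OF bounded_bilinear_blinfun_compose] p(2) q(2))
  ultimately show ?thesis by (rule LIMSEQ_unique)
qed

lemma selfadjoint_cfc:
  assumes T: "positive_op T" and f: "continuous_on {0..norm T} f"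
  shows "selfadjoint (cfc f T)"
  unfolding selfadjoint_def
proof (intro allI)
  fix x y
  obtain p where p: "(\<lambda>n. poly_op (p n) T) \<longlonglongrightarrow> cfc f T"
    using cfc_approximation[OF T f] by blast
  have "selfadjoint T" using T by (simp add: positive_op_def)
  then have eq: "cinner (blinfun_apply (poly_op (p n) T) x) y = cinner x (blinfun_apply (poly_op (p n) T) y)" for n
    by (intro selfadjointD selfadjoint_poly_op)
  have "(\<lambda>n. cinner (blinfun_apply (poly_op (p n) T) x) y) \<longlonglongrightarrow> cinner (blinfun_apply (cfc f T) x) y"
    by (intro cinner.tendsto tendsto_const blinfun.tendsto p)
  moreover have "(\<lambda>n. cinner x (blinfun_apply (poly_op (p n) T) y)) \<longlonglongrightarrow> cinner x (blinfun_apply (cfc f T) y)"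
    by (intro cinner.tendsto tendsto_const blinfun.tendsto p)
  ultimately show "cinner (blinfun_apply (cfc f T) x) y = cinner x (blinfun_apply (cfc f T) y)"
    unfolding eq by (rule LIMSEQ_unique)
qed

lemma norm_cfc_le:
  assumes T: "positive_op T" and f: "continuous_on {0..norm T} f"
    and b: "\<And>t. t \<in> {0..norm T} \<Longrightarrow> \<bar>f t\<bar> \<le> b"
  shows "norm (cfc f T) \<le> b"
proof (rule field_le_epsilon)
  fix e :: real assume "0 < e"
  have sa: "selfadjoint T" using T by (simp add: positive_op_def)
  have "0 \<le> b" using b[of 0] by simp
  obtain p where p: "uniform_limit {0..norm T} (\<lambda>n. poly (p n)) f sequentially"
      "(\<lambda>n. poly_op (p n) T) \<longlonglongrightarrow> cfc f T"
    using cfc_approximation[OF T f] by blast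
  have "\<forall>\<^sub>F n in sequentially. norm (poly_op (p n) T) \<le> b + e"
    using uniform_limitD[OF p(1) \<open>0 < e\<close>]
  proof eventually_elim
    case (elim n)
    show ?case
    proof (rule norm_poly_op_le[OF sa])
      fix t assume "complex_of_real t \<in> spectrum_op T"
      then have "t \<in> {0..norm T}" using real_spectrum_positive_op[OF T] by blast
      then have "\<bar>poly (p n) t - f t\<bar> < e" "\<bar>f t\<bar> \<le> b" using elim b by (auto simp: dist_real_def)
      then show "\<bar>poly (p n) t\<bar> \<le> b + e" by linarith
    qed (use \<open>0 \<le> b\<close> \<open>0 < e\<close> in simp)
  qed
  then show "norm (cfc f T) \<le> b + e"
    using tendsto_norm[OF p(2)] by (intro tendsto_upperbound[of _ _ sequentially]) auto
qed

lemma le_norm_cfc: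
  fixes T :: "'a::chilbert_space \<Rightarrow>\<^sub>L 'a"
  assumes T: "positive_op T" and f: "continuous_on {0..norm T} f" and x0: "x0 \<noteq> (0::'a)"
  shows "\<bar>f (norm T)\<bar> \<le> norm (cfc f T)"
proof -
  obtain p where p: "uniform_limit {0..norm T} (\<lambda>n. poly (p n)) f sequentially"
      "(\<lambda>n. poly_op (p n) T) \<longlonglongrightarrow> cfc f T"
    using cfc_approximation[OF T f] by blast
  have "(\<lambda>n. poly (p n) (norm T)) \<longlonglongrightarrow> f (norm T)"
    by (rule tendsto_uniform_limitI[OF p(1)]) simp
  from LIMSEQ_le[OF tendsto_rabs[OF this] tendsto_norm[OF p(2)]] show ?thesis
    using poly_approx_eigenvalue_le[OF approx_eigenvalue_norm[OF T x0]] by blast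
qed

section \<open>Powers of a positive operator\<close>

lemma continuous_on_powr_const: "0 < s \<Longrightarrow> continuous_on {0..b} (\<lambda>t::real. t powr s)"
  by (intro continuous_on_powr' continuous_on_id continuous_on_const) auto

lemma powr_op_add:
  assumes "positive_op T" "0 < s" "0 < u"
  shows "powr_op T (s + u) = powr_op T s o\<^sub>L powr_op T u"
  unfolding powr_op_def
  by (rule cfc_mult) (use assms in \<open>auto intro: continuous_on_powr_const simp: powr_add\<close>)

text \<open>A positive power is the square of the self-adjoint operator \<open>T\<^bsup>s/2\<^esup>\<close>.\<close>

lemma positive_op_powr_op:
  assumes T: "positive_op T" and s: "0 < s"
  shows "positive_op (powr_op T s)"
proof -
  have sa: "selfadjoint (powr_op T u)" if "0 < u" for u
    unfolding powr_op_def by (rule selfadjoint_cfc[OF T continuous_on_powr_const[OF that]])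
  define G where "G = powr_op T (s / 2)"
  have G: "powr_op T s = G o\<^sub>L G"
    using powr_op_add[OF T, of "s / 2" "s / 2"] s by (simp add: G_def)
  have "selfadjoint G" using sa s by (simp add: G_def)
  then have "Re (cinner (blinfun_apply (powr_op T s) x) x) = (norm (blinfun_apply G x))\<^sup>2" for x
    by (simp add: G selfadjointD norm_square_eq_cinner)
  then show ?thesis using sa[OF s] by (simp add: positive_op_def)
qed

text \<open>The power function is increasing, so its supremum over the spectrum is its value at \<open>\<parallel>T\<parallel>\<close>,
  which is itself an approximate eigenvalue unless the space is zero.\<close>

lemma norm_powr_op:
  fixes T :: "'a::chilbert_space \<Rightarrow>\<^sub>L 'a"
  assumes T: "positive_op T" and s: "0 < s"
  shows "norm (powr_op T s) = norm T powr s"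
proof (cases "\<exists>x0::'a. x0 \<noteq> 0")
  case True
  show ?thesis
  proof (rule antisym)
    show "norm (powr_op T s) \<le> norm T powr s" unfolding powr_op_def
      by (rule norm_cfc_le[OF T continuous_on_powr_const[OF s]]) (use s in \<open>auto intro: powr_mono2\<close>)
    show "norm T powr s \<le> norm (powr_op T s)"
      using le_norm_cfc[OF T continuous_on_powr_const[OF s]] True unfolding powr_op_def by force
  qed
next
  case False
  then have "S = 0" for S :: "'a \<Rightarrow>\<^sub>L 'a" by (intro blinfun_eqI) auto
  from this[of T] this[of "powr_op T s"] show ?thesis by simp
qed

section \<open>Numerical radius of a normal operator\<close>

lemma cmod_cinner_le_norm_op:
  "cmod (cinner (blinfun_apply T x) x) \<le> norm T * (norm (x::'a::chilbert_space))\<^sup>2"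
proof -
  have "cmod (cinner (blinfun_apply T x) x) \<le> norm (blinfun_apply T x) * norm x"
    by (rule cinner_Cauchy_Schwarz)
  also have "\<dots> \<le> norm T * norm x * norm x" by (intro mult_right_mono norm_blinfun) simp
  finally show ?thesis by (simp add: power2_eq_square mult.assoc)
qed

lemma numerical_range_le_norm:
  assumes "s \<in> insert 0 {cmod (cinner (blinfun_apply T x) x) | x. norm (x::'a::chilbert_space) = 1}"
  shows "s \<le> norm T"
  using assms
proof
  assume "s \<in> {cmod (cinner (blinfun_apply T x) x) | x. norm x = 1}"
  then obtain x where "s = cmod (cinner (blinfun_apply T x) x)" "norm x = 1" by blast
  then show ?thesis using cmod_cinner_le_norm_op[of T x] by simp
qed simp

lemma numerical_radius_le_norm: "numerical_radius T \<le> norm T"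
  unfolding numerical_radius_def by (rule cSup_least) (simp, rule numerical_range_le_norm)

lemma bdd_above_numerical_range:
  "bdd_above (insert 0 {cmod (cinner (blinfun_apply T x) x) | x. norm x = 1})"
  by (rule bdd_aboveI) (rule numerical_range_le_norm)

lemma numerical_radius_nonneg: "0 \<le> numerical_radius T"
  unfolding numerical_radius_def by (intro cSup_upper bdd_above_numerical_range) simp

lemma cmod_cinner_le_numerical_radius:
  "cmod (cinner (blinfun_apply T x) x) \<le> numerical_radius T * (norm (x::'a::chilbert_space))\<^sup>2"
proof (cases "x = 0")
  case True
  then show ?thesis by (simp add: cinner.zero_right)
next
  case False
  define u where "u = (1 / norm x) *\<^sub>R x"
  have x: "x = norm x *\<^sub>R u" and "norm u = 1" using False by (simp_all add: u_def)
  then have "cmod (cinner (blinfun_apply T u) u) \<le> numerical_radius T"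
    unfolding numerical_radius_def by (intro cSup_upper bdd_above_numerical_range) auto
  moreover have "cmod (cinner (blinfun_apply T x) x) = (norm x)\<^sup>2 * cmod (cinner (blinfun_apply T u) u)"
    by (subst (1 2) x)
      (simp add: blinfun.scaleR_right cinner.scaleR_left cinner.scaleR_right power2_eq_square norm_mult)
  ultimately show ?thesis by (simp add: mult_right_mono mult.commute[of "(norm x)\<^sup>2"])
qed

text \<open>By orthogonality of the characters of \<open>\<int>/n\<close> the average of the right-hand side over all
  \<open>n\<close>-th roots of unity \<open>z\<close> equals the left-hand side, so some \<open>z\<close> reaches it.\<close>

lemma root_of_unity_sum_norm_ge:
  fixes v :: "nat \<Rightarrow> 'a::chilbert_space"
  assumes "0 < n"
  obtains z where "z ^ n = 1" and "(\<Sum>k<n. (norm (v k))\<^sup>2) \<le> (norm (\<Sum>k<n. z ^ k *\<^sub>C v k))\<^sup>2"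
proof -
  define \<omega> where "\<omega> = exp (2 * of_real pi * \<i> * of_nat 1 / of_nat n)"
  have root: "\<omega> ^ n = 1"
    unfolding \<omega>_def by (rule complex_root_unity) (use assms in simp)
  have pow: "\<omega> ^ k = exp (2 * of_real pi * \<i> * of_nat k / of_nat n)" for k
    unfolding \<omega>_def exp_of_nat_mult[symmetric] by (simp add: field_simps)
  have cmod1: "cmod \<omega> = 1" by (simp add: \<omega>_def)
  have orth: "(\<Sum>j<n. (\<omega> ^ j) ^ k * cnj ((\<omega> ^ j) ^ l)) = (if k = l then of_nat n else 0)"
    if "k < n" "l < n" for k l
  proof -
    define u where "u = \<omega> ^ k * cnj (\<omega> ^ l)"
    have unit: "\<omega> ^ l * cnj (\<omega> ^ l) = 1"
      by (simp only: complex_norm_square[symmetric] norm_power cmod1) simp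
    have "(\<omega> ^ j) ^ k * cnj ((\<omega> ^ j) ^ l) = u ^ j" for j
      by (simp add: u_def power_mult_distrib power_mult[symmetric] mult.commute)
    then have sum: "(\<Sum>j<n. (\<omega> ^ j) ^ k * cnj ((\<omega> ^ j) ^ l)) = (\<Sum>j<n. u ^ j)" by simp
    show ?thesis
    proof (cases "k = l")
      case True
      then have "u = 1" using unit by (simp add: u_def)
      then show ?thesis unfolding sum by (simp add: True)
    next
      case False
      have "u \<noteq> 1"
      proof
        assume "u = 1"
        then have "\<omega> ^ k = \<omega> ^ l"
          using unit unfolding u_def by (metis mult.commute mult.left_commute mult.right_neutral)
        then show False
          using complex_root_unity_eq[of n k l] that False unfolding pow by simp
      qed
      moreover have "u ^ n = (\<omega> ^ n) ^ k * cnj ((\<omega> ^ n) ^ l)"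
        by (simp add: u_def power_mult_distrib power_mult[symmetric] mult.commute)
      then have "u ^ n = 1" by (simp add: root)
      ultimately show ?thesis unfolding sum using False by (simp add: geometric_sum)
    qed
  qed
  define y where "y j = (\<Sum>k<n. (\<omega> ^ j) ^ k *\<^sub>C v k)" for j
  have "(\<Sum>j<n. cinner (y j) (y j))
      = (\<Sum>j<n. \<Sum>k<n. \<Sum>l<n. (\<omega> ^ j) ^ k * cnj ((\<omega> ^ j) ^ l) * cinner (v k) (v l))"
    unfolding y_def cinner.sum_left unfolding cinner.sum_right cinner_scaleC_left cinner_scaleC_right
    by (simp only: mult_ac)
  also have "\<dots> = (\<Sum>k<n. \<Sum>l<n. (\<Sum>j<n. (\<omega> ^ j) ^ k * cnj ((\<omega> ^ j) ^ l)) * cinner (v k) (v l))"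
    unfolding sum_distrib_right
    by (subst sum.swap, rule sum.cong[OF refl], rule sum.swap)
  also have "\<dots> = (\<Sum>k<n. \<Sum>l<n. if k = l then of_nat n * cinner (v k) (v l) else 0)"
    by (intro sum.cong refl) (simp add: orth del: complex_cnj_power)
  also have "\<dots> = (\<Sum>k<n. of_nat n * cinner (v k) (v k))" by simp
  finally have "complex_of_real (\<Sum>j<n. (norm (y j))\<^sup>2) = complex_of_real (\<Sum>k<n. real n * (norm (v k))\<^sup>2)"
    by (simp add: cinner_self)
  then have avg: "(\<Sum>j<n. (norm (y j))\<^sup>2) = real n * (\<Sum>k<n. (norm (v k))\<^sup>2)"
    unfolding of_real_eq_iff by (simp add: sum_distrib_left)
  have "\<exists>j<n. (\<Sum>k<n. (norm (v k))\<^sup>2) \<le> (norm (y j))\<^sup>2"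
  proof (rule ccontr)
    assume "\<not> ?thesis"
    then have "(\<Sum>j<n. (norm (y j))\<^sup>2) < (\<Sum>j<n. \<Sum>k<n. (norm (v k))\<^sup>2)"
      using assms by (intro sum_strict_mono) auto
    then show False by (simp add: avg)
  qed
  then obtain j where "(\<Sum>k<n. (norm (v k))\<^sup>2) \<le> (norm (y j))\<^sup>2" by blast
  moreover have "(\<omega> ^ j) ^ n = 1" by (metis root power_mult mult.commute power_one)
  ultimately show thesis using that[of "\<omega> ^ j"] by (simp add: y_def)
qed

text \<open>The hypothesis makes \<open>k \<mapsto> \<parallel>T\<^sup>k x\<parallel>\<close> logarithmically convex, so the growth ratios never fall
  below the first one. Operators with this property are called paranormal.\<close>

lemma paranormal_power_ge:
  fixes T :: "'a::chilbert_space \<Rightarrow>\<^sub>L 'a"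
  assumes para: "\<And>x. (norm (blinfun_apply T x))\<^sup>2 \<le> norm (blinfun_apply T (blinfun_apply T x)) * norm x"
    and x: "norm x = 1"
  shows "norm (blinfun_apply T x) ^ k \<le> norm ((blinfun_apply T ^^ k) x)"
proof -
  define a where "a k = norm ((blinfun_apply T ^^ k) x)" for k
  have convex: "(a (Suc k))\<^sup>2 \<le> a (Suc (Suc k)) * a k" for k
    using para[of "(blinfun_apply T ^^ k) x"] by (simp add: a_def)
  have growth: "a 1 * a k \<le> a (Suc k)" for k
  proof (induction k)
    case 0
    show ?case by (simp add: a_def x)
  next
    case (Suc k)
    show ?case
    proof (cases "a k = 0")
      case True
      then have "a (Suc k) = 0" using convex[of k] by simp
      then show ?thesis by (simp add: a_def)
    next
      case False
      then have pos: "0 < a k" by (simp add: a_def)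
      have "a 1 * a (Suc k) * a k = a (Suc k) * (a 1 * a k)" by simp
      also have "\<dots> \<le> a (Suc k) * a (Suc k)"
        by (intro mult_left_mono Suc.IH) (simp add: a_def)
      also have "\<dots> \<le> a (Suc (Suc k)) * a k" using convex[of k] by (simp add: power2_eq_square)
      finally show ?thesis using pos by simp
    qed
  qed
  have "a 1 ^ k \<le> a k"
  proof (induction k)
    case 0
    show ?case by (simp add: a_def x)
  next
    case (Suc k)
    have "a 1 * a 1 ^ k \<le> a 1 * a k" by (intro mult_left_mono Suc.IH) (simp add: a_def)
    then show ?case using growth[of k] by simp
  qed
  then show ?thesis by (simp add: a_def)
qed

text \<open>With \<open>M = \<parallel>T\<parallel>\<close>, choose a unit vector \<open>x\<close> such that the vectors \<open>v\<^sub>k = M\<^bsup>-k\<^esup> T\<^sup>k x\<close> have norm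
  between \<open>1/2\<close> and \<open>1\<close> for all \<open>k < n\<close>, and let \<open>y = (\<Sum>k<n. z\<^sup>k v\<^sub>k)\<close> with \<open>z\<^sup>n = 1\<close>. Since \<open>T v\<^sub>k = M v\<^bsub>k+1\<^esub>\<close>,
  the difference \<open>z T y - M y\<close> telescopes to \<open>M (v\<^sub>n - v\<^sub>0)\<close>, which is bounded by \<open>2 M\<close>, while a suitable
  root of unity \<open>z\<close> makes \<open>\<parallel>y\<parallel>\<close> at least \<open>\<surd>n / 2\<close>. So \<open>y\<close> is nearly an eigenvector for an eigenvalue of
  modulus \<open>M\<close>, and \<open>\<bar>\<langle>T y, y\<rangle>\<bar> / \<parallel>y\<parallel>\<^sup>2\<close> falls short of \<open>M\<close> by at most \<open>4 M / \<surd>n\<close>.\<close>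

lemma numerical_radius_paranormal:
  fixes T :: "'a::chilbert_space \<Rightarrow>\<^sub>L 'a"
  assumes T: "T \<in> bounded_ops"
    and para: "\<And>x. (norm (blinfun_apply T x))\<^sup>2 \<le> norm (blinfun_apply T (blinfun_apply T x)) * norm x"
  shows "numerical_radius T = norm T"
proof (cases "norm T = 0")
  case True
  then show ?thesis using numerical_radius_le_norm[of T] numerical_radius_nonneg[of T] by simp
next
  case False
  define M where "M = norm T"
  define w where "w = numerical_radius T"
  have M: "0 < M" using False by (simp add: M_def)
  have bound: "M \<le> w + 4 * M / sqrt (real n)" if n: "0 < n" for n
  proof -
    (* so that (c / M) ^ n is at least 1/2, by Bernoulli *)
    define c where "c = M * (1 - 1 / (2 * real n))"
    have c: "0 \<le> c" "c < M" using M n by (simp_all add: c_def field_simps)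
    obtain x where x: "norm x = 1" "c \<le> norm (blinfun_apply T x)"
    proof -
      have "\<exists>x. c * norm x < norm (blinfun_apply T x)"
      proof (rule ccontr)
        assume "\<not> ?thesis"
        then have "norm T \<le> c" using c(1) by (intro norm_blinfun_bound) (auto simp: not_less)
        then show False using c(2) by (simp add: M_def)
      qed
      then obtain x where x: "c * norm x < norm (blinfun_apply T x)" by blast
      then have "x \<noteq> 0" by (auto simp: blinfun.zero_right)
      then show thesis using x that[of "(1 / norm x) *\<^sub>R x"]
        by (simp add: blinfun.scaleR_right field_simps)
    qed
    define v where "v k = (1 / M) ^ k *\<^sub>R (blinfun_apply T ^^ k) x" for k
    have v_ge: "1 / 2 \<le> norm (v k)" if "k < n" for k
    proof -
      have half: "(1::real) / 2 \<le> (1 - 1 / (2 * real n)) ^ n"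
        using Bernoulli_inequality[of "- (1 / (2 * real n))" n] n by (simp add: field_simps)
      also have "\<dots> \<le> (1 - 1 / (2 * real n)) ^ k"
        using n that by (intro power_decreasing) (auto simp: field_simps)
      also have "1 - 1 / (2 * real n) = 1 / M * c" using M by (simp add: c_def)
      also have "(1 / M * c) ^ k = (1 / M) ^ k * c ^ k" by (rule power_mult_distrib)
      also have "c ^ k \<le> norm (blinfun_apply T x) ^ k" using x(2) c(1) by (intro power_mono)
      also have "\<dots> \<le> norm ((blinfun_apply T ^^ k) x)" by (rule paranormal_power_ge[OF para x(1)])
      finally show ?thesis using M by (simp add: v_def mult_left_mono)
    qed
    have v_le: "norm (v k) \<le> 1" for k
    proof -
      have "norm ((blinfun_apply T ^^ k) x) \<le> M ^ k"
      proof (induction k)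
        case (Suc k)
        have "norm (blinfun_apply T ((blinfun_apply T ^^ k) x)) \<le> M * norm ((blinfun_apply T ^^ k) x)"
          unfolding M_def by (rule norm_blinfun)
        also have "\<dots> \<le> M * M ^ k" using M by (intro mult_left_mono Suc.IH) simp
        finally show ?case by simp
      qed (simp add: x(1))
      then show ?thesis using M by (simp add: v_def power_divide divide_le_eq)
    qed
    have Tv: "blinfun_apply T (v k) = M *\<^sub>R v (Suc k)" for k
      using M by (simp add: v_def blinfun.scaleR_right)
    obtain z where z: "z ^ n = 1" and ge: "(\<Sum>k<n. (norm (v k))\<^sup>2) \<le> (norm (\<Sum>k<n. z ^ k *\<^sub>C v k))\<^sup>2"
      using root_of_unity_sum_norm_ge[OF n] by blast
    define y where "y = (\<Sum>k<n. z ^ k *\<^sub>C v k)"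
    have cmod_z: "cmod z = 1"
      using arg_cong[OF z, of cmod] n power_eq_imp_eq_base[of "cmod z" n 1]
      by (simp add: norm_power)
    have "real n / 4 = (\<Sum>k<n. (1 / 2)\<^sup>2)" by (simp add: power2_eq_square)
    also have "\<dots> \<le> (\<Sum>k<n. (norm (v k))\<^sup>2)" using v_ge by (intro sum_mono power_mono) auto
    also have "\<dots> \<le> (norm y)\<^sup>2" using ge by (simp add: y_def)
    finally have "sqrt (real n / 4) \<le> norm y" by (rule real_le_lsqrt[OF norm_ge_zero])
    then have y_ge: "sqrt (real n) / 2 \<le> norm y" by (simp add: real_sqrt_divide)
    have "z *\<^sub>C blinfun_apply T y = (\<Sum>k<n. M *\<^sub>R (z ^ Suc k *\<^sub>C v (Suc k)))"
      using T by (simp add: y_def blinfun.sum_right scaleC.sum_right bounded_ops_def Tv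
          scaleC_scaleC scaleC.scaleR_right)
    also have "\<dots> = M *\<^sub>R ((\<Sum>k<Suc n. z ^ k *\<^sub>C v k) - v 0)"
      by (simp only: sum.lessThan_Suc_shift scaleR_sum_right[symmetric]) (simp add: scaleC_one)
    also have "(\<Sum>k<Suc n. z ^ k *\<^sub>C v k) = y + v n" by (simp add: y_def z scaleC_one)
    finally have shift: "z *\<^sub>C blinfun_apply T y = M *\<^sub>R y + M *\<^sub>R (v n - v 0)"
      by (simp add: scaleR_add_right scaleR_diff_right)
    have "M * (norm y)\<^sup>2 = Re (cinner (z *\<^sub>C blinfun_apply T y) y) - M * Re (cinner (v n - v 0) y)"
      unfolding shift by (simp add: cinner.add_left cinner.scaleR_left cinner_self)
    also have "\<dots> \<le> w * (norm y)\<^sup>2 + M * (2 * norm y)"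
    proof -
      have "Re (cinner (z *\<^sub>C blinfun_apply T y) y) \<le> cmod (cinner (blinfun_apply T y) y)"
        using complex_Re_le_cmod[of "cinner (z *\<^sub>C blinfun_apply T y) y"]
        by (simp add: cinner_scaleC_left norm_mult cmod_z)
      also have "\<dots> \<le> w * (norm y)\<^sup>2" unfolding w_def by (rule cmod_cinner_le_numerical_radius)
      finally have 1: "Re (cinner (z *\<^sub>C blinfun_apply T y) y) \<le> w * (norm y)\<^sup>2" .
      have "- Re (cinner (v n - v 0) y) \<le> norm (v n - v 0) * norm y"
        using abs_Re_le_cmod[of "cinner (v n - v 0) y"] cinner_Cauchy_Schwarz[of "v n - v 0" y] by linarith
      also have "\<dots> \<le> 2 * norm y"
        using norm_triangle_ineq4[of "v n" "v 0"] v_le[of n] v_le[of 0] by (intro mult_right_mono) auto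
      finally have "M * - Re (cinner (v n - v 0) y) \<le> M * (2 * norm y)"
        using M by (intro mult_left_mono) auto
      then show ?thesis using 1 by simp
    qed
    finally have main: "M * (norm y)\<^sup>2 \<le> w * (norm y)\<^sup>2 + M * (2 * norm y)" .
    have s: "0 < sqrt (real n) / 2" using n by simp
    then have y: "0 < norm y" using y_ge by linarith
    have "M * norm y * norm y \<le> (w * norm y + 2 * M) * norm y"
      using main by (simp add: power2_eq_square algebra_simps)
    then have "M * norm y \<le> w * norm y + 2 * M" using y by simp
    then have "M \<le> w + 2 * M / norm y" using y by (simp add: field_simps)
    also have "2 * M / norm y \<le> 2 * M / (sqrt (real n) / 2)"
      by (intro divide_left_mono) (use M s y y_ge in auto)
    finally show ?thesis by simp
  qed
  have "(\<lambda>n. w + 4 * M * inverse (sqrt (real n))) \<longlonglongrightarrow> w + 4 * M * 0"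
    by (intro tendsto_intros tendsto_inverse_0_at_top
        filterlim_compose[OF sqrt_at_top filterlim_real_sequentially])
  then have "M \<le> w + 4 * M * 0"
    by (rule tendsto_lowerbound)
      (use bound in \<open>auto simp: divide_inverse intro!: eventually_sequentiallyI[of 1]\<close>)
  then show ?thesis using numerical_radius_le_norm[of T] by (simp add: M_def w_def)
qed

lemma norm_adjoint_apply_normal:
  assumes T: "T \<in> bounded_ops" and normal: "normal_op T"
  shows "norm (blinfun_apply (adj_op T) x) = norm (blinfun_apply T x)"
proof -
  have "blinfun_apply (adj_op T) (blinfun_apply T x) = blinfun_apply T (blinfun_apply (adj_op T) x)"
    using normal unfolding normal_op_def by (metis blinfun_apply_blinfun_compose)
  then have "cinner (blinfun_apply (adj_op T) x) (blinfun_apply (adj_op T) x)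
      = cinner (blinfun_apply T x) (blinfun_apply T x)"
    by (simp only: cinner_adjoint[OF T] cinner_adjoint'[OF T])
  then have "(norm (blinfun_apply (adj_op T) x))\<^sup>2 = (norm (blinfun_apply T x))\<^sup>2"
    by (simp add: norm_square_eq_cinner)
  then show ?thesis by simp
qed

text \<open>For normal \<open>T\<close> one has \<open>\<parallel>T\<^sup>* y\<parallel> = \<parallel>T y\<parallel>\<close>, hence
  \<open>\<parallel>T x\<parallel>\<^sup>2 = \<langle>x, T\<^sup>* T x\<rangle> \<le> \<parallel>x\<parallel> \<parallel>T T x\<parallel>\<close>: a normal operator is paranormal.\<close>

lemma numerical_radius_normal:
  assumes T: "T \<in> bounded_ops" and "normal_op T"
  shows "numerical_radius T = norm T"
proof (rule numerical_radius_paranormal[OF T])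
  fix x
  have "(norm (blinfun_apply T x))\<^sup>2 = Re (cinner x (blinfun_apply (adj_op T) (blinfun_apply T x)))"
    by (simp only: norm_square_eq_cinner cinner_adjoint[OF T])
  also have "\<dots> \<le> norm x * norm (blinfun_apply (adj_op T) (blinfun_apply T x))"
    using complex_Re_le_cmod cinner_Cauchy_Schwarz by (rule order_trans)
  also have "\<dots> = norm (blinfun_apply T (blinfun_apply T x)) * norm x"
    by (simp add: norm_adjoint_apply_normal[OF assms])
  finally show "(norm (blinfun_apply T x))\<^sup>2 \<le> norm (blinfun_apply T (blinfun_apply T x)) * norm x" .
qed

section \<open>The modulus\<close>

lemma positive_op_adjoint_compose:
  assumes T: "T \<in> bounded_ops"
  shows "positive_op (adj_op T o\<^sub>L T)"
  unfolding positive_op_def selfadjoint_def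
  by (simp add: cinner_adjoint[OF T] cinner_adjoint'[OF T] cinner_self)

lemma norm_adjoint_compose:
  assumes T: "T \<in> bounded_ops"
  shows "norm (adj_op T o\<^sub>L T) = (norm T)\<^sup>2"
proof (rule antisym)
  let ?S = "adj_op T o\<^sub>L T"
  have "norm (blinfun_apply T x) \<le> sqrt (norm ?S) * norm x" for x
  proof -
    have "(norm (blinfun_apply T x))\<^sup>2 = Re (cinner (blinfun_apply ?S x) x)"
      by (simp add: norm_square_eq_cinner cinner_adjoint'[OF T])
    also have "\<dots> \<le> norm ?S * (norm x)\<^sup>2"
      using complex_Re_le_cmod cmod_cinner_le_norm_op by (rule order_trans)
    finally show ?thesis using real_sqrt_le_mono by (fastforce simp: real_sqrt_mult)
  qed
  then have "norm T \<le> sqrt (norm ?S)" by (intro norm_blinfun_bound) auto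
  then have "(norm T)\<^sup>2 \<le> (sqrt (norm ?S))\<^sup>2" by (intro power_mono) auto
  then show "(norm T)\<^sup>2 \<le> norm ?S" by simp
  have adj: "norm (blinfun_apply (adj_op T) y) \<le> norm T * norm y" for y
  proof (cases "blinfun_apply (adj_op T) y = 0")
    case False
    let ?z = "blinfun_apply (adj_op T) y"
    have "norm ?z * norm ?z = Re (cinner (blinfun_apply T ?z) y)"
      by (simp add: cinner_adjoint[OF T] norm_square_eq_cinner[symmetric] power2_eq_square[symmetric])
    also have "\<dots> \<le> norm (blinfun_apply T ?z) * norm y"
      using complex_Re_le_cmod cinner_Cauchy_Schwarz by (rule order_trans)
    also have "\<dots> \<le> norm T * norm ?z * norm y" by (intro mult_right_mono norm_blinfun) simp
    finally show ?thesis using False by (simp add: mult.commute mult.left_commute)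
  qed simp
  then have "norm (adj_op T) \<le> norm T" by (intro norm_blinfun_bound) auto
  then show "norm ?S \<le> (norm T)\<^sup>2"
    using norm_blinfun_compose[of "adj_op T" T]
    by (smt (verit) mult_right_mono norm_ge_zero power2_eq_square)
qed

lemma positive_op_abs_op: "T \<in> bounded_ops \<Longrightarrow> positive_op (abs_op T)"
  unfolding abs_op_def by (intro positive_op_powr_op positive_op_adjoint_compose) auto

lemma norm_abs_op: "T \<in> bounded_ops \<Longrightarrow> norm (abs_op T) = norm T"
  unfolding abs_op_def
  by (simp add: norm_powr_op positive_op_adjoint_compose norm_adjoint_compose powr_half_sqrt)

lemma abs_op_adjoint_normal:
  assumes "T \<in> bounded_ops" "normal_op T"
  shows "abs_op (adj_op T) = abs_op T"
  using assms unfolding abs_op_def normal_op_def by (simp add: adj_op_adj_op)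

theorem proposition5p3:
  fixes A :: "'a::chilbert_space \<Rightarrow>\<^sub>L 'a" and r :: real
  assumes "A \<in> bounded_ops" and "normal_op A" and "r \<ge> 1"
  shows "numerical_radius A powr (2 * r) =
      1/4 * norm (powr_op (abs_op A) (2 * r) + powr_op (abs_op (adj_op A)) (2 * r)) +
      1/2 * spectral_radius_op (powr_op (abs_op A) r o\<^sub>L powr_op (abs_op (adj_op A)) r)"
proof -
  define P where "P = abs_op A"
  have P: "positive_op P" unfolding P_def using assms(1) by (rule positive_op_abs_op)
  have adj: "abs_op (adj_op A) = P" unfolding P_def using assms(1,2) by (rule abs_op_adjoint_normal)
  have r: "0 < r" using assms(3) by simp
  have sum: "norm (powr_op P (2 * r) + powr_op P (2 * r)) = 2 * norm (powr_op P (2 * r))"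
    unfolding scaleR_2[symmetric] by simp
  have "powr_op P r o\<^sub>L powr_op P r = powr_op P (2 * r)"
    using powr_op_add[OF P r r] by simp
  then have rad: "spectral_radius_op (powr_op P r o\<^sub>L powr_op P r) = norm (powr_op P (2 * r))"
    using P r by (simp add: spectral_radius_positive_op positive_op_powr_op)
  have "norm (powr_op P (2 * r)) = numerical_radius A powr (2 * r)"
    using norm_powr_op[OF P, of "2 * r"] r numerical_radius_normal[OF assms(1,2)]
      norm_abs_op[OF assms(1)] by (simp add: P_def)
  then show ?thesis unfolding adj P_def[symmetric] sum rad by simp
qed

end
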